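(* For every integer $k>1$ the set $\mathcal{P}_k^\nabla[\mathbb{R}^2]$ is empty; that is, there is no proper gradient map $f\colon\mathbb{R}^2\to\mathbb{R}^2$ with Brouwer degree $\deg f=k$.
   Context: "Map" means continuous function; $I=[0,1]$. A map $f\colon\mathbb{R}^n\to\mathbb{R}^n$ is gradient if there is a $C^1$ function $\varphi\colon\mathbb{R}^n\to\mathbb{R}$ with $f=\nabla\varphi$; a map is proper if preimages of compact sets are compact. $\deg$ denotes the classical Brouwer degree (with respect to the value $0$, computed on any bounded open set containing the compact set $f^{-1}(0)$). Let $\mathcal{P}_k^\nabla(\mathbb{R}^n)$ be the set of proper gradient maps $f\colon\mathbb{R}^n\to\mathbb{R}^n$ with $\deg f=k$. A proper gradient homotopy is a proper map $h\colon I\times\mathbb{R}^n\to\mathbb{R}^n$ such that $h_t=h(t,\cdot)$ is gradient for each $t\in I$; then $h_0$ and $h_1$ are called proper gradient homotopic. This is an equivalence relation on $\mathcal{P}_k^\nabla(\mathbb{R}^n)$, and $\mathcal{P}_k^\nabla[\mathbb{R}^n]$ denotes the set of its equivalence classes. *)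

theory Defs
  imports "HOL-Analysis.Analysis"
begin

definition C1_on :: "'a::real_normed_vector set \<Rightarrow> ('a \<Rightarrow> 'b::real_normed_vector) \<Rightarrow> bool" where
  "C1_on U g \<longleftrightarrow>
     (\<exists>g' :: 'a \<Rightarrow> 'a \<Rightarrow>\<^sub>L 'b.
        (\<forall>x\<in>U. (g has_derivative blinfun_apply (g' x)) (at x)) \<and> continuous_on U g')"

text \<open>
  The analytic definition of the Brouwer degree of a continuous map \<open>f : closure U \<rightarrow> \<real>\<^sup>n\<close>, with
  \<open>U\<close> bounded and open and \<open>y \<notin> f(frontier U)\<close>: approximate \<open>f\<close> within the distance from \<open>y\<close> to
  \<open>f(frontier U)\<close> by a map \<open>g\<close> that is \<open>C\<^sup>1\<close> on \<open>U\<close> and has \<open>y\<close> as a regular value, and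
  count the solutions of \<open>g x = y\<close> in \<open>U\<close> with the signs of the Jacobian determinants. Such \<open>g\<close>
  exist, have finitely many solutions in \<open>U\<close>, and all give the same number.
\<close>

definition degree_approx ::
  "(real^'n \<Rightarrow> real^'n) \<Rightarrow> (real^'n) set \<Rightarrow> real^'n \<Rightarrow> (real^'n \<Rightarrow> real^'n) \<Rightarrow> bool" where
  "degree_approx f U y g \<longleftrightarrow>
     continuous_on (closure U) g \<and> C1_on U g \<and>
     (\<forall>x\<in>closure U. dist (f x) (g x) < infdist y (f ` frontier U)) \<and>
     (\<forall>x\<in>U. g x = y \<longrightarrow> det (jacobian g (at x)) \<noteq> 0)"

definition brouwer_degree ::
  "(real^'n \<Rightarrow> real^'n) \<Rightarrow> (real^'n) set \<Rightarrow> real^'n \<Rightarrow> int" where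
  "brouwer_degree f U y =
     (THE d. \<exists>g. degree_approx f U y g \<and>
        of_int d = (\<Sum>x | x \<in> U \<and> g x = y. sgn (det (jacobian g (at x)))))"

text \<open>
  For a continuous map with compact zero set, any bounded open set containing the zeros gives the
  same degree with respect to \<open>0\<close>, by excision; we take a ball about the origin.
\<close>

definition deg :: "(real^'n \<Rightarrow> real^'n) \<Rightarrow> int" where
  "deg f = brouwer_degree f (ball 0 (SOME R. R > 0 \<and> f -` {0} \<subseteq> ball 0 R)) 0"

definition proper_on ::
  "'a::topological_space set \<Rightarrow> ('a \<Rightarrow> 'b::topological_space) \<Rightarrow> bool" where
  "proper_on S f \<longleftrightarrow> continuous_on S f \<and> (\<forall>K. compact K \<longrightarrow> compact (S \<inter> f -` K))"

definition gradient_map :: "(real^'n \<Rightarrow> real^'n) \<Rightarrow> bool" where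
  "gradient_map f \<longleftrightarrow>
     (\<exists>\<phi> :: real^'n \<Rightarrow> real. C1_on UNIV \<phi> \<and> (\<forall>x. GDERIV \<phi> x :> f x))"

definition proper_gradient_maps :: "int \<Rightarrow> (real^'n \<Rightarrow> real^'n) set" where
  "proper_gradient_maps k = {f. proper_on UNIV f \<and> gradient_map f \<and> deg f = k}"

definition proper_gradient_homotopic ::
  "(real^'n \<Rightarrow> real^'n) \<Rightarrow> (real^'n \<Rightarrow> real^'n) \<Rightarrow> bool" where
  "proper_gradient_homotopic f g \<longleftrightarrow>
     (\<exists>h :: real \<times> (real^'n) \<Rightarrow> real^'n.
        proper_on ({0..1} \<times> UNIV) h \<and>
        (\<forall>t\<in>{0..1}. gradient_map (\<lambda>x. h (t, x))) \<and>
        (\<forall>x. h (0, x) = f x) \<and> (\<forall>x. h (1, x) = g x))"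

definition proper_gradient_classes :: "int \<Rightarrow> (real^'n \<Rightarrow> real^'n) set set" where
  "proper_gradient_classes k =
     proper_gradient_maps k //
       {(f, g). f \<in> proper_gradient_maps k \<and> g \<in> proper_gradient_maps k \<and>
                proper_gradient_homotopic f g}"

end

theory Submission
  imports Defs "HOL-Complex_Analysis.Complex_Analysis"
begin

text \<open>
  Let \<open>f = \<nabla>\<phi>\<close> satisfy \<open>\<bar>f\<bar> \<ge> 2\<close> outside \<open>B\<^sub>R\<close> and \<open>\<bar>\<phi>\<bar> \<le> M\<close> on \<open>B\<^sub>R\<^sub>+\<^sub>1\<close>. In the plane the
  degree of \<open>f\<close> is its winding number along the circle of radius \<open>R + 1\<close>. Iterated Euler steps
  along \<open>f\<close>, frozen on \<open>B\<^sub>R\<close>, increase \<open>\<phi>\<close> at a rate bounded below by the length of the path; so a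
  long trajectory either climbs as high as we please or stays near \<open>B\<^sub>R\<close>. Descending instead, every
  point of \<open>{\<phi> \<le> M}\<close> is connected to \<open>0\<close> inside \<open>{\<phi> \<le> M}\<close>, so each component \<open>U\<close> of \<open>{\<phi> > M}\<close> has
  connected complement. If \<open>{\<phi> \<le> M}\<close> is unbounded, then \<open>U\<close> is simply connected and contracts to a
  point \<open>q\<^sub>U \<in> U\<close>. Flowing up for a long time and then contracting the components gives a map of a
  large disc into its interior whose fixed points outside \<open>B\<^sub>R\<^sub>+\<^sub>1\<close> are finitely many points \<open>q\<^sub>U\<close>,
  each of index 1, while its fixed point index on \<open>B\<^sub>R\<^sub>+\<^sub>1\<close> is the degree of \<open>f\<close>. As the total index
  is 1, the degree is 1 minus the number of these points. If \<open>{\<phi> \<le> M}\<close> is bounded, then \<open>\<phi>\<close> is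
  bounded below and the argument for \<open>-\<phi>\<close> with a larger \<open>M\<close> has no components to contract.
\<close>

section \<open>Winding numbers around circles\<close>

text \<open>The value is complex, like \<open>winding_number\<close>; it is an integer when
  \<open>r \<ge> 0\<close> and \<open>h\<close> is continuous and nonzero on the circle.\<close>

definition circ_wn :: "(complex \<Rightarrow> complex) \<Rightarrow> complex \<Rightarrow> real \<Rightarrow> complex" where
  "circ_wn h a r = winding_number (h \<circ> circlepath a r) 0"

lemma circlepath_in_sphere: "r \<ge> 0 \<Longrightarrow> t \<in> {0..1} \<Longrightarrow> circlepath a r t \<in> sphere a r"
  by (metis abs_of_nonneg imageI path_image_circlepath path_image_def)

lemma circ_wn_cong:
  assumes "r \<ge> 0" "\<And>x. x \<in> sphere a r \<Longrightarrow> g x = h x"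
  shows "circ_wn g a r = circ_wn h a r"
  unfolding circ_wn_def
  by (rule winding_number_cong) (use assms circlepath_in_sphere[OF assms(1)] in auto)

lemma path_circ:
  assumes "r \<ge> 0" "continuous_on (sphere a r) h"
  shows "path (h \<circ> circlepath a r)" "pathfinish (h \<circ> circlepath a r) = pathstart (h \<circ> circlepath a r)"
    "path_image (h \<circ> circlepath a r) = h ` sphere a r"
proof -
  show "path (h \<circ> circlepath a r)"
    using assms by (intro path_continuous_image) (auto simp: path_image_circlepath)
  show "pathfinish (h \<circ> circlepath a r) = pathstart (h \<circ> circlepath a r)"
    by (simp add: pathfinish_compose pathstart_compose)
  show "path_image (h \<circ> circlepath a r) = h ` sphere a r"
    using assms by (simp add: path_image_compose path_image_circlepath)
qed

section \<open>Homotopy invariance and its consequences\<close>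

lemma circ_wn_homotopy:
  fixes H :: "real \<times> complex \<Rightarrow> complex"
  assumes "r \<ge> 0" "continuous_on ({0..1} \<times> sphere a r) H"
    and "\<And>t x. t \<in> {0..1} \<Longrightarrow> x \<in> sphere a r \<Longrightarrow> H (t, x) \<noteq> 0"
  shows "circ_wn (\<lambda>x. H (0, x)) a r = circ_wn (\<lambda>x. H (1, x)) a r"
proof -
  have im: "circlepath a r x \<in> sphere a r" if "x \<in> {0..1}" for x
    using circlepath_in_sphere[OF assms(1) that] .
  have "continuous_on ({0..1} \<times> {0..1}) (\<lambda>z. H (fst z, circlepath a r (snd z)))"
    by (rule continuous_on_compose2[OF assms(2)])
       (use im in \<open>auto simp: circlepath intro!: continuous_intros\<close>)
  then have "homotopic_loops (-{0}) ((\<lambda>x. H (0, x)) \<circ> circlepath a r) ((\<lambda>x. H (1, x)) \<circ> circlepath a r)"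
    unfolding homotopic_loops
    by (intro exI[of _ "\<lambda>z. H (fst z, circlepath a r (snd z))"])
       (use im assms(3) in \<open>auto simp: pathfinish_def pathstart_def circlepath\<close>)
  then show ?thesis
    unfolding circ_wn_def by (rule winding_number_homotopic_loops)
qed

lemma circ_wn_linear:
  assumes "r \<ge> 0" "continuous_on (sphere a r) g" "continuous_on (sphere a r) h"
    and "\<And>x. x \<in> sphere a r \<Longrightarrow> 0 \<notin> closed_segment (g x) (h x)"
  shows "circ_wn g a r = circ_wn h a r"
proof -
  have "continuous_on ({0..1} \<times> sphere a r) (\<lambda>z. (1 - fst z) *\<^sub>R g (snd z) + fst z *\<^sub>R h (snd z))"
    by (intro continuous_intros continuous_on_compose2[OF assms(2)] continuous_on_compose2[OF assms(3)]) auto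
  from circ_wn_homotopy[OF assms(1) this] show ?thesis
    using assms(4) by (force simp: closed_segment_def)
qed

text \<open>Since \<open>circ_wn_homotopy\<close> works over one fixed circle, both circles are
  pulled back to the unit circle around \<open>a\<close> and joined radially through the
  annulus.\<close>

lemma circ_wn_scale:
  assumes "0 < r" "r \<le> s" "continuous_on (cball a s - ball a r) h"
    and "\<And>x. x \<in> cball a s - ball a r \<Longrightarrow> h x \<noteq> 0"
  shows "circ_wn h a r = circ_wn h a s"
proof -
  define G where "G = (\<lambda>z::real\<times>complex. a + ((1 - fst z) * r + fst z * s) *\<^sub>R (snd z - a))"
  have im: "G z \<in> cball a s - ball a r" if zin: "z \<in> {0..1} \<times> sphere a 1" for z
  proof -
    obtain t x where z: "z = (t,x)" "0 \<le> t" "t \<le> 1" "dist a x = 1" using zin by (cases z) auto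
    define u where "u = (1 - t) * r + t * s"
    have e: "u = r + t * (s - r)" by (simp add: u_def algebra_simps)
    have sr: "0 \<le> s - r" using assms(2) by simp
    have u: "r \<le> u" "u \<le> s"
      unfolding e using mult_nonneg_nonneg[OF z(2) sr] mult_right_mono[OF z(3) sr] by simp_all
    have "G z - a = u *\<^sub>R (x - a)" by (simp add: G_def z(1) u_def)
    then have "dist a (G z) = \<bar>u\<bar> * dist a x"
      by (metis dist_commute dist_norm norm_scaleR)
    then have "dist a (G z) = u" using u(1) assms(1) z(4) by simp
    then show ?thesis using u by auto
  qed
  have "continuous_on ({0..1} \<times> sphere a 1) G"
    unfolding G_def by (intro continuous_intros)
  then have "continuous_on ({0..1} \<times> sphere a 1) (h \<circ> G)"
    by (rule continuous_on_compose[OF _ continuous_on_subset[OF assms(3)]]) (use im in blast)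
  then have "circ_wn (\<lambda>x. (h \<circ> G) (0, x)) a 1 = circ_wn (\<lambda>x. (h \<circ> G) (1, x)) a 1"
    by (rule circ_wn_homotopy[rotated]) (use im assms(4) in \<open>unfold o_def, blast, simp\<close>)
  moreover have "circ_wn (\<lambda>x. (h \<circ> G) (0, x)) a 1 = circ_wn h a r" "circ_wn (\<lambda>x. (h \<circ> G) (1, x)) a 1 = circ_wn h a s"
    unfolding circ_wn_def by (auto simp: G_def circlepath scaleR_conv_of_real intro!: winding_number_cong)
  ultimately show ?thesis by simp
qed

text \<open>Shrinking the circle radially to its centre deforms \<open>h\<close> to the constant
  \<open>h a\<close>.\<close>

lemma circ_wn_disc:
  assumes "0 \<le> r" "continuous_on (cball a r) h" "\<And>x. x \<in> cball a r \<Longrightarrow> h x \<noteq> 0"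
  shows "circ_wn h a r = 0"
proof -
  have "continuous_on ({0..1} \<times> sphere a r) (\<lambda>z::real\<times>complex. h (a + fst z *\<^sub>R (snd z - a)))"
    by (rule continuous_on_compose2[OF assms(2)])
       (use assms(1) in \<open>auto simp: dist_norm norm_minus_commute mult_left_le_one_le intro!: continuous_intros\<close>)
  from circ_wn_homotopy[OF assms(1) this] 
  have "circ_wn (\<lambda>x. h a) a r = circ_wn h a r"
    using assms by (simp add: dist_norm norm_minus_commute mult_left_le_one_le)
  moreover have "circ_wn (\<lambda>x. h a) a r = 0"
    unfolding circ_wn_def o_def using assms by (intro winding_number_zero_const) auto
  ultimately show ?thesis by simp
qed

lemma circ_wn_const: "r \<ge> 0 \<Longrightarrow> c \<noteq> 0 \<Longrightarrow> circ_wn (\<lambda>x. c) a r = 0"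
  by (rule circ_wn_disc) auto

section \<open>Logarithms along a circle: products and powers\<close>

lemma circ_wn_log:
  assumes "r \<ge> 0" "continuous_on (sphere a r) h" "\<And>x. x \<in> sphere a r \<Longrightarrow> h x \<noteq> 0"
  obtains q where "path q" "\<And>t. t \<in> {0..1} \<Longrightarrow> h (circlepath a r t) = exp (q t)"
    "pathfinish q - pathstart q = 2 * of_real pi * \<i> * circ_wn h a r"
proof -
  obtain q where "path q" "pathfinish q - pathstart q = 2 * of_real pi * \<i> * winding_number (h \<circ> circlepath a r) 0"
     "\<And>t. t \<in> {0..1} \<Longrightarrow> (h \<circ> circlepath a r) t = 0 + exp(q t)"
    by (rule winding_number_as_continuous_log[OF path_circ(1)[OF assms(1,2)], of 0])
       (use path_circ(3)[OF assms(1,2)] assms(3) in auto)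
  then show ?thesis using that by (auto simp: circ_wn_def)
qed

text \<open>Together with \<open>circ_wn_log\<close> this makes the winding number the increment of
  a continuous logarithm divided by \<open>2 * pi * \<i>\<close>; logarithms of products add, and
  those of integer powers scale.\<close>

lemma circ_wn_exp:
  assumes "path q" "\<And>t. t \<in> {0..1} \<Longrightarrow> h (circlepath a r t) = exp (q t)"
  shows "circ_wn h a r = (pathfinish q - pathstart q) / (2 * of_real pi * \<i>)"
  unfolding circ_wn_def winding_number_compose_exp[OF assms(1), symmetric]
  by (rule winding_number_cong) (use assms(2) in auto)

lemma circ_wn_mult:
  assumes r: "r \<ge> 0" and g: "continuous_on (sphere a r) g" "\<And>x. x \<in> sphere a r \<Longrightarrow> g x \<noteq> 0"
    and h: "continuous_on (sphere a r) h" "\<And>x. x \<in> sphere a r \<Longrightarrow> h x \<noteq> 0"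
  shows "circ_wn (\<lambda>x. g x * h x) a r = circ_wn g a r + circ_wn h a r"
proof -
  obtain p where p: "path p" "\<And>t. t \<in> {0..1} \<Longrightarrow> g (circlepath a r t) = exp (p t)"
    "pathfinish p - pathstart p = 2 * of_real pi * \<i> * circ_wn g a r"
    using circ_wn_log[OF r g] by metis
  obtain q where q: "path q" "\<And>t. t \<in> {0..1} \<Longrightarrow> h (circlepath a r t) = exp (q t)"
    "pathfinish q - pathstart q = 2 * of_real pi * \<i> * circ_wn h a r"
    using circ_wn_log[OF r h] by metis
  have "circ_wn (\<lambda>x. g x * h x) a r = (pathfinish (\<lambda>t. p t + q t) - pathstart (\<lambda>t. p t + q t)) / (2 * of_real pi * \<i>)"
    by (rule circ_wn_exp) (use p q in \<open>auto simp: path_def exp_add intro!: continuous_intros\<close>)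
  also have "\<dots> = ((pathfinish p - pathstart p) + (pathfinish q - pathstart q)) / (2 * of_real pi * \<i>)"
    by (simp add: pathfinish_def pathstart_def)
  also have "\<dots> = circ_wn g a r + circ_wn h a r"
    unfolding p(3) q(3) by (simp add: add_divide_distrib)
  finally show ?thesis .
qed

lemma circ_wn_minus:
  assumes "r \<ge> 0" "continuous_on (sphere a r) h" "\<And>x. x \<in> sphere a r \<Longrightarrow> h x \<noteq> 0"
  shows "circ_wn (\<lambda>x. - h x) a r = circ_wn h a r"
proof -
  have "circ_wn (\<lambda>x. (-1) * h x) a r = circ_wn (\<lambda>x. -1) a r + circ_wn h a r"
    by (rule circ_wn_mult) (use assms in auto)
  moreover have "circ_wn (\<lambda>x. -1) a r = 0"
    by (rule circ_wn_disc) (use assms in auto)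
  ultimately show ?thesis by simp
qed

lemma circ_wn_powi:
  assumes r: "r \<ge> 0" and g: "continuous_on (sphere a r) g" "\<And>x. x \<in> sphere a r \<Longrightarrow> g x \<noteq> 0"
  shows "circ_wn (\<lambda>x. g x powi n) a r = of_int n * circ_wn g a r"
proof -
  obtain p where p: "path p" "\<And>t. t \<in> {0..1} \<Longrightarrow> g (circlepath a r t) = exp (p t)"
    "pathfinish p - pathstart p = 2 * of_real pi * \<i> * circ_wn g a r"
    using circ_wn_log[OF r g] by metis
  have "circ_wn (\<lambda>x. g x powi n) a r = (pathfinish (\<lambda>t. of_int n * p t) - pathstart (\<lambda>t. of_int n * p t)) / (2 * of_real pi * \<i>)"
    by (rule circ_wn_exp) (use p in \<open>auto simp: path_def exp_power_int intro!: continuous_intros\<close>)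
  also have "\<dots> = of_int n * (pathfinish p - pathstart p) / (2 * of_real pi * \<i>)"
    by (simp add: pathfinish_def pathstart_def algebra_simps)
  also have "\<dots> = of_int n * circ_wn g a r" unfolding p(3) by (simp add: field_simps)
  finally show ?thesis .
qed

section \<open>Isolated zeros and the winding numbers around them\<close>

lemma circ_wn_diff:
  assumes "r > 0" "b \<notin> sphere a r"
  shows "circ_wn (\<lambda>x. x - b) a r = (if b \<in> ball a r then 1 else 0)"
proof -
  have "circ_wn (\<lambda>x. x - b) a r = winding_number (circlepath a r) b"
    unfolding circ_wn_def winding_number_offset[of "circlepath a r"] by (simp add: o_def)
  also have "\<dots> = (if b \<in> ball a r then 1 else 0)"
  proof (cases "b \<in> ball a r")
    case True then show ?thesis using assms
      by (auto intro!: winding_number_circlepath simp: dist_norm norm_minus_commute)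
  next
    case False then show ?thesis using assms
      by (auto intro!: winding_number_zero_outside[of _ "cball a r"] simp: path_image_circlepath)
  qed
  finally show ?thesis .
qed

text \<open>Winding number zero makes the loop null-homotopic in the punctured plane, and a
  null-homotopic map from a circle into it extends over the disc.\<close>

lemma circ_wn_extend:
  assumes r: "r > 0" and g: "continuous_on (sphere a r) g" "\<And>x. x \<in> sphere a r \<Longrightarrow> g x \<noteq> 0"
    and "circ_wn g a r = 0"
  obtains f where "continuous_on (cball a r) f" "\<And>x. x \<in> cball a r \<Longrightarrow> f x \<noteq> 0" "\<And>x. x \<in> sphere a r \<Longrightarrow> f x = g x"
proof -
  have r0: "r \<ge> 0" using r by simp
  have "0 \<notin> path_image (g \<circ> circlepath a r)" using g(2) path_circ(3)[OF r0 g(1)] by auto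
  then obtain c where "homotopic_loops (-{0}) (g \<circ> circlepath a r) (\<lambda>t. c)"
    using winding_number_homotopic_loops_null_eq[of "g \<circ> circlepath a r" 0] path_circ[OF r0 g(1)] assms(4)
    unfolding circ_wn_def by metis
  from homotopic_loops_imp_homotopic_circlemaps[OF this]
  have "homotopic_with_canon (\<lambda>h. True) (sphere 0 1) (-{0})
      ((g \<circ> circlepath a r) \<circ> (\<lambda>z. Arg2pi z / (2 * pi))) (\<lambda>z. c)" by (simp add: o_def)
  \<comment> \<open>\<open>Arg2pi\<close> inverts the parametrisation of the circle, so the loop
    becomes \<open>g\<close> read on the unit circle after an affine change of variable.\<close>
  then have "homotopic_with_canon (\<lambda>h. True) (sphere 0 1) (-{0}) (\<lambda>z. g (a + of_real r * z)) (\<lambda>z. c)"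
  proof (rule homotopic_with_eq)
    fix z :: complex assume "z \<in> topspace (top_of_set (sphere 0 1))"
    then have n: "norm z = 1" by simp
    have "exp (\<i> * of_real (Arg2pi z)) = z" using Arg2pi_eq[of z] n by simp
    then have "circlepath a r (Arg2pi z / (2 * pi)) = a + of_real r * z"
      by (simp add: circlepath mult_ac)
    then show "g (a + of_real r * z) = ((g \<circ> circlepath a r) \<circ> (\<lambda>z. Arg2pi z / (2 * pi))) z" by simp
  qed auto
  then obtain f where f: "continuous_on (cball 0 1) f" "f ` cball 0 1 \<subseteq> -{0}"
      "\<And>z. z \<in> sphere 0 1 \<Longrightarrow> f z = g (a + of_real r * z)"
    using nullhomotopic_from_sphere_extension[of 0 1 "-{0}" "\<lambda>z. g (a + of_real r * z)"] by blast
  have *: "(x - a) / of_real r \<in> cball 0 1" if "x \<in> cball a r" for x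
    using that r by (simp add: norm_divide dist_norm norm_minus_commute)
  show ?thesis
  proof (rule that[of "\<lambda>x. f ((x - a) / of_real r)"])
    show "continuous_on (cball a r) (\<lambda>x. f ((x - a) / of_real r))"
      by (rule continuous_on_compose2[OF f(1)]) (use * r in \<open>auto intro!: continuous_intros\<close>)
    show "f ((x - a) / of_real r) \<noteq> 0" if "x \<in> cball a r" for x using f(2) *[OF that] by auto
    show "f ((x - a) / of_real r) = g x" if "x \<in> sphere a r" for x
      using f(3)[of "(x - a) / of_real r"] that r by (simp add: norm_divide dist_norm norm_minus_commute)
  qed
qed


text \<open>
  After division by \<open>(x - a) powi w a\<close> the winding number around a zero \<open>a\<close> is \<open>0\<close>, so the values
  near \<open>a\<close> can be replaced by a nonvanishing extension from a small circle.
\<close>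

lemma remove_zeros:
  assumes "finite S" "S \<subseteq> interior X" "open V" "S \<subseteq> V"
    and "continuous_on (X - S) h" "\<And>x. x \<in> X - S \<Longrightarrow> h x \<noteq> 0"
    and "\<And>a. a \<in> S \<Longrightarrow> \<forall>\<^sub>F e in at_right 0. circ_wn h a e = of_int (w a)"
  shows "\<exists>g. continuous_on X g \<and> (\<forall>x\<in>X. g x \<noteq> 0) \<and>
    (\<forall>x\<in>X - V. h x = g x * (\<Prod>a\<in>S. (x - a) powi w a))"
  using assms
proof (induction S arbitrary: h V rule: finite_induct)
  case empty
  then show ?case by (intro exI[of _ h]) auto
next
  case (insert a S)
  have "open (interior X \<inter> V - S)" "a \<in> interior X \<inter> V - S"
    using insert.prems insert.hyps by (auto intro: open_Diff finite_imp_closed)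
  then obtain e0 where e0: "e0 > 0" "cball a e0 \<subseteq> interior X \<inter> V - S"
    by (meson open_contains_cball)
  have "\<forall>\<^sub>F e in at_right 0. circ_wn h a e = of_int (w a) \<and> e < e0 \<and> e > 0"
    using insert.prems(6)[of a] eventually_at_right_real[OF e0(1)]
    by (auto elim: eventually_elim2)
  from eventually_happens'[OF trivial_limit_at_right_real this]
  obtain e where e: "circ_wn h a e = of_int (w a)" "0 < e" "e < e0" by blast
  have ce: "cball a e \<subseteq> interior X \<inter> V - S" using e0(2) e(3) by (meson order_less_imp_le order_trans subset_cball)
  have iX: "interior X \<subseteq> X" by (rule interior_subset)
  define h1 where "h1 = (\<lambda>x. h x * (x - a) powi (- w a))"
  have h1c: "continuous_on (X - insert a S) h1"
    unfolding h1_def by (intro continuous_intros insert.prems) auto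
  have h1n: "h1 x \<noteq> 0" if "x \<in> X - insert a S" for x
    using insert.prems(5)[OF that] that unfolding h1_def by auto
  have sph: "sphere a e \<subseteq> X - insert a S" using ce iX e(2) by force
  have "circ_wn h1 a e = circ_wn h a e + circ_wn (\<lambda>x. (x - a) powi (- w a)) a e"
    unfolding h1_def
    by (rule circ_wn_mult)
      (use e(2) insert.prems(5) sph in \<open>auto intro!: continuous_intros continuous_on_subset[OF insert.prems(4)]\<close>)
  also have "circ_wn (\<lambda>x. (x - a) powi (- w a)) a e = of_int (- w a) * circ_wn (\<lambda>x. x - a) a e"
    by (rule circ_wn_powi) (use e(2) in \<open>auto intro!: continuous_intros\<close>)
  also have "circ_wn (\<lambda>x. x - a) a e = 1"
    using circ_wn_diff[of e a a] e(2) by simp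
  finally have "circ_wn h1 a e = 0" using e(1) by simp
  from circ_wn_extend[OF e(2) _ _ this] obtain f where f: "continuous_on (cball a e) f"
    "\<And>x. x \<in> cball a e \<Longrightarrow> f x \<noteq> 0" "\<And>x. x \<in> sphere a e \<Longrightarrow> f x = h1 x"
    using continuous_on_subset[OF h1c sph] h1n sph by (metis subsetD)
  define h2 where "h2 = (\<lambda>x. if x \<in> cball a e then f x else h1 x)"
  have "continuous_on (cball a e \<union> (X - S - ball a e)) h2"
    unfolding h2_def
  proof (rule continuous_on_cases_local)
    show "closedin (top_of_set (cball a e \<union> (X - S - ball a e))) (cball a e)"
      by (auto intro!: closed_subset)
    have "X - S - ball a e = (cball a e \<union> (X - S - ball a e)) \<inter> (- ball a e)"
      using ce iX by auto
    then show "closedin (top_of_set (cball a e \<union> (X - S - ball a e))) (X - S - ball a e)"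
      by (metis closedin_closed_Int open_ball closed_Compl)
    show "continuous_on (X - S - ball a e) h1"
      by (rule continuous_on_subset[OF h1c]) (use e(2) in auto)
  qed (use f in auto)
  moreover have "cball a e \<union> (X - S - ball a e) = X - S" using ce iX by auto
  ultimately have h2c: "continuous_on (X - S) h2" by simp
  have h2n: "h2 x \<noteq> 0" if "x \<in> X - S" for x
    using f(2)[of x] h1n[of x] that e(2) unfolding h2_def by (cases "x = a") auto
  have "\<exists>g. continuous_on X g \<and> (\<forall>x\<in>X. g x \<noteq> 0) \<and>
    (\<forall>x\<in>X - (V - cball a e). h2 x = g x * (\<Prod>a\<in>S. (x - a) powi w a))"
  proof (rule insert.IH)
    show "S \<subseteq> interior X" using insert.prems by auto
    show "open (V - cball a e)" using insert.prems by auto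
    show "S \<subseteq> V - cball a e" using insert.prems ce by auto
    \<comment> \<open>The remaining points keep their winding numbers: near \<open>b\<close> the map
      \<open>h2\<close> differs from \<open>h\<close> only by a power of \<open>x - a\<close>, which
      has no zero on a small disc around \<open>b\<close>.\<close>
    fix b assume b: "b \<in> S"
    have "open (interior X - (S - {b}) - cball a e)" "b \<in> interior X - (S - {b}) - cball a e"
      using b insert.prems(1) insert.hyps(1) ce by (auto intro!: open_Diff finite_imp_closed)
    then obtain d where d: "d > 0" "cball b d \<subseteq> interior X - (S - {b}) - cball a e"
      by (meson open_contains_cball)
    have ev: "\<forall>\<^sub>F r in at_right 0. 0 < r \<and> r < d"
      using eventually_at_right_real[OF d(1)] by (auto elim: eventually_mono)
    show "\<forall>\<^sub>F r in at_right 0. circ_wn h2 b r = of_int (w b)"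
      using eventually_conj[OF ev insert.prems(6)[of b]] b
    proof (simp, elim eventually_mono, goal_cases)
      case (1 r)
      have cb: "cball b r \<subseteq> interior X - (S - {b}) - cball a e"
        using d(2) 1 by (meson order_less_imp_le order_trans subset_cball)
      have "a \<in> cball a e" using e(2) by simp
      then have "cball b r \<inter> insert a S \<subseteq> {b}" using cb by blast
      moreover have "b \<notin> sphere b r" "b \<noteq> a" using 1 insert.hyps by auto
      ultimately have sb: "sphere b r \<subseteq> X - insert a S" "a \<notin> cball b r"
        using cb iX sphere_cball[of b r] by blast+
      have hn: "h x \<noteq> 0" if "x \<in> sphere b r" for x using that sb(1) insert.prems(5) by blast
      have "circ_wn h2 b r = circ_wn h1 b r"
        by (rule circ_wn_cong) (use 1 cb in \<open>auto simp: h2_def\<close>)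
      also have "\<dots> = circ_wn h b r + circ_wn (\<lambda>x. (x - a) powi (- w a)) b r"
        unfolding h1_def
        by (rule circ_wn_mult)
          (use 1 hn sb in \<open>auto intro!: continuous_intros continuous_on_subset[OF insert.prems(4)]\<close>)
      also have "circ_wn (\<lambda>x. (x - a) powi (- w a)) b r = 0"
        by (rule circ_wn_disc) (use 1 sb in \<open>auto intro!: continuous_intros\<close>)
      finally show ?case using 1 by simp
    qed
  qed (use h2c h2n in auto)
  then obtain g where g: "continuous_on X g" "\<forall>x\<in>X. g x \<noteq> 0"
    "\<And>x. x \<in> X - (V - cball a e) \<Longrightarrow> h2 x = g x * (\<Prod>a\<in>S. (x - a) powi w a)" by auto
  have "h x = g x * (\<Prod>a\<in>insert a S. (x - a) powi w a)" if x: "x \<in> X - V" for x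
  proof -
    have "x \<notin> cball a e" "x \<noteq> a" using x ce insert.prems by auto
    then have "h x = h2 x * (x - a) powi w a" by (simp add: h2_def h1_def power_int_minus)
    also have "h2 x = g x * (\<Prod>a\<in>S. (x - a) powi w a)" using g(3) x by auto
    finally show ?thesis using insert.hyps by (simp add: mult_ac)
  qed
  then show ?case using g by blast
qed

lemma circ_wn_prod:
  assumes "finite S" "r \<ge> 0" "\<And>a. a \<in> S \<Longrightarrow> continuous_on (sphere c r) (g a)"
    "\<And>a x. a \<in> S \<Longrightarrow> x \<in> sphere c r \<Longrightarrow> g a x \<noteq> 0"
  shows "circ_wn (\<lambda>x. \<Prod>a\<in>S. g a x) c r = (\<Sum>a\<in>S. circ_wn (g a) c r)"
  using assms(1,3,4)
proof (induction S rule: finite_induct)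
  case empty
  then show ?case using assms(2) by (simp add: circ_wn_disc)
next
  case (insert a S)
  then show ?case using assms(2)
    by (simp, subst circ_wn_mult) (auto intro!: continuous_intros)
qed


text \<open>With \<open>V\<close> the open disc, \<open>remove_zeros\<close> factors
  \<open>h\<close> on the boundary circle into a map that is zero-free on the whole disc, hence of
  winding number \<open>0\<close>, and powers that wind \<open>w a\<close> times each.\<close>

lemma circ_wn_eq_sum_disc:
  assumes "finite S" "S \<subseteq> ball c r" "r > 0"
    and "continuous_on (cball c r - S) h" "\<And>x. x \<in> cball c r - S \<Longrightarrow> h x \<noteq> 0"
    and "\<And>a. a \<in> S \<Longrightarrow> \<forall>\<^sub>F e in at_right 0. circ_wn h a e = of_int (w a)"
  shows "circ_wn h c r = of_int (\<Sum>a\<in>S. w a)"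
proof -
  obtain g where g: "continuous_on (cball c r) g" "\<And>x. x \<in> cball c r \<Longrightarrow> g x \<noteq> 0"
    "\<And>x. x \<in> cball c r - ball c r \<Longrightarrow> h x = g x * (\<Prod>a\<in>S. (x - a) powi w a)"
    using remove_zeros[of S "cball c r" "ball c r" h w] assms by auto
  have S: "x \<noteq> a" if "a \<in> S" "dist c x = r" for a x using that assms(2) by auto
  have r0: "r \<ge> 0" using assms(3) by simp
  have "circ_wn h c r = circ_wn (\<lambda>x. g x * (\<Prod>a\<in>S. (x - a) powi w a)) c r"
    by (rule circ_wn_cong) (use assms(3) g(3) in auto)
  also have "\<dots> = circ_wn g c r + circ_wn (\<lambda>x. \<Prod>a\<in>S. (x - a) powi w a) c r"
    by (rule circ_wn_mult)
       (use r0 g S assms(1) in \<open>auto intro!: continuous_intros intro: continuous_on_subset\<close>)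
  also have "circ_wn (\<lambda>x. \<Prod>a\<in>S. (x - a) powi w a) c r = (\<Sum>a\<in>S. circ_wn (\<lambda>x. (x - a) powi w a) c r)"
    by (rule circ_wn_prod) (use r0 S assms(1) in \<open>auto intro!: continuous_intros\<close>)
  also have "\<dots> = (\<Sum>a\<in>S. of_int (w a))"
  proof (rule sum.cong[OF refl])
    fix a assume a: "a \<in> S"
    have "circ_wn (\<lambda>x. (x - a) powi w a) c r = of_int (w a) * circ_wn (\<lambda>x. x - a) c r"
      by (rule circ_wn_powi) (use r0 S[OF a] in \<open>auto intro!: continuous_intros\<close>)
    then show "circ_wn (\<lambda>x. (x - a) powi w a) c r = of_int (w a)"
      using circ_wn_diff[of r a c] a assms by auto
  qed
  also have "circ_wn g c r = 0"
    by (rule circ_wn_disc) (use g r0 in auto)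
  finally show ?thesis by simp
qed

text \<open>The zero-free factor from \<open>remove_zeros\<close> winds equally on both circles;
  each \<open>x - a\<close> winds once on the outer circle and not at all on the inner one.\<close>

lemma circ_wn_eq_sum_annulus:
  assumes "finite S" "S \<subseteq> ball c s - cball c r" "r > 0" "r < s"
    and "continuous_on (cball c s - ball c r - S) h" "\<And>x. x \<in> cball c s - ball c r - S \<Longrightarrow> h x \<noteq> 0"
    and "\<And>a. a \<in> S \<Longrightarrow> \<forall>\<^sub>F e in at_right 0. circ_wn h a e = of_int (w a)"
  shows "circ_wn h c s = circ_wn h c r + of_int (\<Sum>a\<in>S. w a)"
proof -
  let ?X = "cball c s - ball c r" and ?V = "ball c s - cball c r"
  have "?V \<subseteq> interior ?X" by (rule interior_maximal) auto
  then have "S \<subseteq> interior ?X" using assms(2) by auto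
  from remove_zeros[OF assms(1) this open_Diff[OF open_ball closed_cball] assms(2,5-7)]
  obtain g where g: "continuous_on ?X g" "\<And>x. x \<in> ?X \<Longrightarrow> g x \<noteq> 0"
    "\<And>x. x \<in> ?X - ?V \<Longrightarrow> h x = g x * (\<Prod>a\<in>S. (x - a) powi w a)" by blast
  have *: "circ_wn h c t = circ_wn g c t + (\<Sum>a\<in>S. of_int (w a) * circ_wn (\<lambda>x. x - a) c t)"
    if t: "t = r \<or> t = s" for t
  proof -
    have S: "x \<noteq> a" if "a \<in> S" "dist c x = t" for a x using that assms(2) t by auto
    have t0: "t \<ge> 0" using assms(3,4) t by auto
    have sub: "sphere c t \<subseteq> ?X - ?V" using t assms(3,4) by auto
    have "circ_wn h c t = circ_wn (\<lambda>x. g x * (\<Prod>a\<in>S. (x - a) powi w a)) c t"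
      using t0 g(3) sub by (intro circ_wn_cong) blast+
    also have "\<dots> = circ_wn g c t + circ_wn (\<lambda>x. \<Prod>a\<in>S. (x - a) powi w a) c t"
      by (rule circ_wn_mult)
         (use t0 g S assms(1) sub in \<open>auto intro!: continuous_intros intro: continuous_on_subset\<close>)
    also have "circ_wn (\<lambda>x. \<Prod>a\<in>S. (x - a) powi w a) c t = (\<Sum>a\<in>S. circ_wn (\<lambda>x. (x - a) powi w a) c t)"
      by (rule circ_wn_prod) (use t0 S assms(1) in \<open>auto intro!: continuous_intros\<close>)
    also have "\<dots> = (\<Sum>a\<in>S. of_int (w a) * circ_wn (\<lambda>x. x - a) c t)"
      by (intro sum.cong[OF refl] circ_wn_powi) (use t0 S in \<open>auto intro!: continuous_intros\<close>)
    finally show ?thesis .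
  qed
  have "(\<Sum>a\<in>S. of_int (w a) * circ_wn (\<lambda>x. x - a) c r) = 0"
    by (rule sum.neutral) (use circ_wn_diff[of r _ c] assms(2,3) in fastforce)
  moreover have "(\<Sum>a\<in>S. of_int (w a) * circ_wn (\<lambda>x. x - a) c s) = (\<Sum>a\<in>S. of_int (w a))"
    by (rule sum.cong) (use circ_wn_diff[of s _ c] assms(2,3,4) in fastforce)+
  moreover have "circ_wn g c r = circ_wn g c s"
    by (rule circ_wn_scale) (use g assms in auto)
  ultimately show ?thesis using *[of r] *[of s] by simp
qed

section \<open>The planar degree as a winding number\<close>

text \<open>
  A real-linear map of the plane has the form \<open>h \<mapsto> \<alpha> h + \<beta> cnj h\<close>, with determinant \<open>\<bar>\<alpha>\<bar>\<^sup>2 - \<bar>\<beta>\<bar>\<^sup>2\<close>.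
\<close>

lemma circ_wn_real_linear:
  assumes "r > 0" and "norm \<alpha> \<noteq> norm \<beta>"
  shows "circ_wn (\<lambda>x. \<alpha> * (x - a) + \<beta> * cnj (x - a)) a r = of_real (sgn ((norm \<alpha>)\<^sup>2 - (norm \<beta>)\<^sup>2))"
proof (cases "norm \<beta> < norm \<alpha>")
  case True
  then have \<alpha>: "\<alpha> \<noteq> 0" by auto
  \<comment> \<open>The term with the larger coefficient dominates on the circle, so the straight
    line to it avoids \<open>0\<close>.\<close>
  have "circ_wn (\<lambda>x. \<alpha> * (x - a) + \<beta> * cnj (x - a)) a r = circ_wn (\<lambda>x. \<alpha> * (x - a)) a r"
  proof (rule circ_wn_linear)
    fix x assume x: "x \<in> sphere a r"
    show "0 \<notin> closed_segment (\<alpha> * (x - a) + \<beta> * cnj (x - a)) (\<alpha> * (x - a))"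
    proof
      assume "0 \<in> closed_segment (\<alpha> * (x - a) + \<beta> * cnj (x - a)) (\<alpha> * (x - a))"
      then have "norm (\<alpha> * (x - a)) \<le> norm (\<beta> * cnj (x - a))"
        using segment_bound[of 0 "\<alpha> * (x - a)" "\<alpha> * (x - a) + \<beta> * cnj (x - a)"] by (simp add: closed_segment_commute)
      moreover have "norm (x - a) > 0" using x assms(1) by auto
      ultimately show False using True unfolding norm_mult complex_mod_cnj by simp
    qed
  qed (use assms in \<open>auto intro!: continuous_intros\<close>)
  also have "\<dots> = circ_wn (\<lambda>x. \<alpha>) a r + circ_wn (\<lambda>x. x - a) a r"
    by (rule circ_wn_mult) (use assms \<alpha> in \<open>auto intro!: continuous_intros\<close>)
  also have "\<dots> = 1" using circ_wn_const[of r \<alpha> a] circ_wn_diff[of r a a] assms \<alpha> by simp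
  finally show ?thesis using True by (simp add: power_strict_mono sgn_if)
next
  case False
  then have lt: "norm \<alpha> < norm \<beta>" using assms(2) by simp
  then have \<beta>: "\<beta> \<noteq> 0" by auto
  have "circ_wn (\<lambda>x. \<alpha> * (x - a) + \<beta> * cnj (x - a)) a r = circ_wn (\<lambda>x. \<beta> * cnj (x - a)) a r"
  proof (rule circ_wn_linear)
    fix x assume x: "x \<in> sphere a r"
    show "0 \<notin> closed_segment (\<alpha> * (x - a) + \<beta> * cnj (x - a)) (\<beta> * cnj (x - a))"
    proof
      assume "0 \<in> closed_segment (\<alpha> * (x - a) + \<beta> * cnj (x - a)) (\<beta> * cnj (x - a))"
      then have "norm (\<beta> * cnj (x - a)) \<le> norm (\<alpha> * (x - a))"
        using segment_bound[of 0 "\<beta> * cnj (x - a)" "\<alpha> * (x - a) + \<beta> * cnj (x - a)"] by (simp add: closed_segment_commute)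
      moreover have "norm (x - a) > 0" using x assms(1) by auto
      ultimately show False using lt unfolding norm_mult complex_mod_cnj by simp
    qed
  qed (use assms in \<open>auto intro!: continuous_intros\<close>)
  \<comment> \<open>On the circle conjugation is the inversion
    \<open>cnj (x - a) = r\<^sup>2 / (x - a)\<close>, whence the winding number
    \<open>-1\<close>.\<close>
  also have "\<dots> = circ_wn (\<lambda>x. (\<beta> * of_real (r\<^sup>2)) * (x - a) powi (-1)) a r"
  proof (rule circ_wn_cong)
    fix x assume "x \<in> sphere a r"
    then have n: "norm (x - a) = r" "x - a \<noteq> 0" using assms(1) by (auto simp: dist_norm norm_minus_commute)
    have "cnj (x - a) * (x - a) = of_real (r\<^sup>2)"
      using complex_norm_square[of "x - a"] n(1) by (simp add: mult.commute)
    then have "cnj (x - a) = of_real (r\<^sup>2) / (x - a)" using n(2) by (simp add: nonzero_eq_divide_eq)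
    then show "\<beta> * cnj (x - a) = (\<beta> * of_real (r\<^sup>2)) * (x - a) powi (-1)"
      by (simp add: power_int_minus divide_inverse)
  qed (use assms in auto)
  also have "\<dots> = circ_wn (\<lambda>x. \<beta> * of_real (r\<^sup>2)) a r + circ_wn (\<lambda>x. (x - a) powi (-1)) a r"
    by (rule circ_wn_mult) (use assms \<beta> in \<open>auto intro!: continuous_intros\<close>)
  also have "circ_wn (\<lambda>x. (x - a) powi (-1)) a r = of_int (-1) * circ_wn (\<lambda>x. x - a) a r"
    by (rule circ_wn_powi) (use assms in \<open>auto intro!: continuous_intros\<close>)
  also have "circ_wn (\<lambda>x. \<beta> * of_real (r\<^sup>2)) a r + of_int (-1) * circ_wn (\<lambda>x. x - a) a r = -1" 
    using circ_wn_const[of r "\<beta> * of_real (r\<^sup>2)" a] circ_wn_diff[of r a a] assms \<beta> by simp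
  finally show ?thesis using lt by (simp add: power_strict_mono sgn_if not_less less_imp_le)
qed

lemma real_linear_lower_bound:
  "norm (\<alpha> * h + \<beta> * cnj h) \<ge> \<bar>norm \<alpha> - norm \<beta>\<bar> * norm h"
proof -
  have "\<bar>norm (\<alpha> * h) - norm (- (\<beta> * cnj h))\<bar> \<le> norm (\<alpha> * h - (- (\<beta> * cnj h)))"
    by (rule norm_triangle_ineq3)
  moreover have "norm (\<alpha> * h) - norm (- (\<beta> * cnj h)) = (norm \<alpha> - norm \<beta>) * norm h"
    by (simp add: norm_mult algebra_simps)
  ultimately show ?thesis by (simp add: abs_mult)
qed

text \<open>The linear part is at least a positive multiple of \<open>norm (x - a)\<close>, and near
  \<open>a\<close> the error is at most half of that. This isolates the zero and lets the linear
  part replace \<open>g\<close> on small circles.\<close>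

lemma regular_zero:
  assumes D: "(g has_derivative (\<lambda>h. \<alpha> * h + \<beta> * cnj h)) (at a)" and ga: "g a = 0"
    and ne: "norm \<alpha> \<noteq> norm \<beta>"
  obtains d where "d > 0" 
    "\<And>x. 0 < norm (x - a) \<Longrightarrow> norm (x - a) < d \<Longrightarrow> 
       norm (g x - (\<alpha> * (x - a) + \<beta> * cnj (x - a))) < norm (\<alpha> * (x - a) + \<beta> * cnj (x - a))"
proof -
  define m where "m = \<bar>norm \<alpha> - norm \<beta>\<bar>"
  have m: "m > 0" using ne by (simp add: m_def)
  then obtain d where d: "d > 0" "\<And>x. norm (x - a) < d \<Longrightarrow>
      norm (g x - g a - (\<alpha> * (x - a) + \<beta> * cnj (x - a))) \<le> (m / 2) * norm (x - a)"
    using D unfolding has_derivative_at_alt by (meson half_gt_zero)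
  show ?thesis
  proof (rule that[OF d(1)])
    fix x assume x: "0 < norm (x - a)" "norm (x - a) < d"
    have "norm (g x - (\<alpha> * (x - a) + \<beta> * cnj (x - a))) \<le> (m / 2) * norm (x - a)"
      using d(2)[OF x(2)] ga by simp
    also have "\<dots> < m * norm (x - a)" using m x by simp
    also have "\<dots> \<le> norm (\<alpha> * (x - a) + \<beta> * cnj (x - a))"
      unfolding m_def by (rule real_linear_lower_bound)
    finally show "norm (g x - (\<alpha> * (x - a) + \<beta> * cnj (x - a))) < norm (\<alpha> * (x - a) + \<beta> * cnj (x - a))" .
  qed
qed

lemma not_in_segment_if_near: "norm (g - h) < norm h \<Longrightarrow> 0 \<notin> closed_segment g h"
  for g h :: complex
  using segment_bound(2)[of 0 g h] by (auto simp: norm_minus_commute)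

lemma circ_wn_regular_zero:
  assumes D: "(g has_derivative (\<lambda>h. \<alpha> * h + \<beta> * cnj h)) (at a)" and ga: "g a = 0"
    and ne: "norm \<alpha> \<noteq> norm \<beta>" and U: "open U" "a \<in> U" "continuous_on U g"
  shows "\<forall>\<^sub>F r in at_right 0. circ_wn g a r = of_real (sgn ((norm \<alpha>)\<^sup>2 - (norm \<beta>)\<^sup>2))"
proof -
  obtain d where d: "d > 0" "\<And>x. 0 < norm (x - a) \<Longrightarrow> norm (x - a) < d \<Longrightarrow> 
       norm (g x - (\<alpha> * (x - a) + \<beta> * cnj (x - a))) < norm (\<alpha> * (x - a) + \<beta> * cnj (x - a))"
    using regular_zero[OF D ga ne] by blast
  obtain e where e: "e > 0" "cball a e \<subseteq> U" using U by (meson open_contains_cball)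
  have "min d e > 0" using d e by simp
  from eventually_at_right_real[OF this] show ?thesis
  proof eventually_elim
    case (elim r)
    have sub: "sphere a r \<subseteq> U" using e elim by (auto simp: subset_iff)
    have "circ_wn g a r = circ_wn (\<lambda>x. \<alpha> * (x - a) + \<beta> * cnj (x - a)) a r"
    proof (rule circ_wn_linear)
      show "continuous_on (sphere a r) g" using U(3) sub continuous_on_subset by blast
      fix x assume "x \<in> sphere a r"
      then have "norm (x - a) = r" by (simp add: dist_norm norm_minus_commute)
      then show "0 \<notin> closed_segment (g x) (\<alpha> * (x - a) + \<beta> * cnj (x - a))"
        using d(2)[of x] elim by (intro not_in_segment_if_near) auto
    qed (use elim in \<open>auto intro!: continuous_intros\<close>)
    then show ?case using circ_wn_real_linear[OF _ ne] elim by simp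
  qed
qed

section \<open>The identification of the plane with the complex numbers\<close>

definition to_complex :: "real^2 \<Rightarrow> complex" where "to_complex x = Complex (vec_nth x 1) (vec_nth x 2)"
definition of_complex :: "complex \<Rightarrow> real^2" where "of_complex z = vector [Re z, Im z]"

lemma to_of_complex [simp]: "to_complex (of_complex z) = z" "of_complex (to_complex x) = x"
  by (simp_all add: to_complex_def of_complex_def complex_eq_iff vec_eq_iff forall_2)

lemma inner_to_complex: "to_complex x \<bullet> to_complex y = x \<bullet> y"
  by (simp add: to_complex_def inner_vec_def sum_2 inner_complex_def)

lemma norm_to_complex [simp]: "norm (to_complex x) = norm x"
  by (simp add: norm_eq_sqrt_inner inner_to_complex)

lemma linear_to_complex: "linear to_complex" and linear_of_complex: "linear of_complex"
  by (auto intro!: linearI simp: to_complex_def of_complex_def complex_eq_iff vec_eq_iff forall_2)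

lemma norm_of_complex [simp]: "norm (of_complex z) = norm z"
  by (metis norm_to_complex to_of_complex(1))

lemma bounded_linear_to_complex: "bounded_linear to_complex" and bounded_linear_of_complex: "bounded_linear of_complex"
  using linear_to_complex linear_of_complex linear_conv_bounded_linear by blast+

lemmas to_complex_simps = linear_diff[OF linear_to_complex] linear_0[OF linear_to_complex]
  linear_diff[OF linear_of_complex] linear_0[OF linear_of_complex]

lemma to_complex_eq_0 [simp]: "to_complex x = 0 \<longleftrightarrow> x = 0"
  by (metis norm_to_complex norm_eq_zero)

lemma continuous_on_to_complex [continuous_intros]:
  "continuous_on S h \<Longrightarrow> continuous_on S (\<lambda>x. to_complex (h x))"
  by (rule bounded_linear.continuous_on[OF bounded_linear_to_complex])

lemma continuous_on_of_complex [continuous_intros]: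
  "continuous_on S h \<Longrightarrow> continuous_on S (\<lambda>x. of_complex (h x))"
  by (rule bounded_linear.continuous_on[OF bounded_linear_of_complex])

definition conj_map :: "(real^2 \<Rightarrow> real^2) \<Rightarrow> complex \<Rightarrow> complex" where
  "conj_map f z = to_complex (f (of_complex z))"

text \<open>\<open>\<alpha>\<close> and \<open>\<beta>\<close> are the Wirtinger derivatives with
  respect to \<open>z\<close> and its conjugate, read off from the Jacobian matrix.\<close>

lemma conj_map_derivative:
  assumes "(g has_derivative G) (at (of_complex a))"
  defines "A \<equiv> matrix G"
  defines "\<alpha> \<equiv> Complex ((vec_nth (vec_nth A 1) 1 + vec_nth (vec_nth A 2) 2) / 2) ((vec_nth (vec_nth A 2) 1 - vec_nth (vec_nth A 1) 2) / 2)"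
    and "\<beta> \<equiv> Complex ((vec_nth (vec_nth A 1) 1 - vec_nth (vec_nth A 2) 2) / 2) ((vec_nth (vec_nth A 2) 1 + vec_nth (vec_nth A 1) 2) / 2)"
  shows "(conj_map g has_derivative (\<lambda>h. \<alpha> * h + \<beta> * cnj h)) (at a)"
    and "(norm \<alpha>)\<^sup>2 - (norm \<beta>)\<^sup>2 = det A"
proof -
  have "((\<lambda>z. to_complex (g (of_complex z))) has_derivative (\<lambda>h. to_complex (G (of_complex h)))) (at a)"
    by (rule bounded_linear.has_derivative[OF bounded_linear_to_complex])
       (rule has_derivative_compose[OF bounded_linear_imp_has_derivative[OF bounded_linear_of_complex] assms(1)])
  moreover have "to_complex (G (of_complex h)) = \<alpha> * h + \<beta> * cnj h" for h
  proof -
    have "G (of_complex h) = A *v of_complex h"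
      unfolding A_def using has_derivative_linear[OF assms(1)]
      by (simp add: matrix_works linear_matrix_vector_mul_eq)
    then show ?thesis
      by (simp add: to_complex_def of_complex_def matrix_vector_mult_def sum_2 \<alpha>_def \<beta>_def complex_eq_iff field_simps)
  qed
  ultimately show "(conj_map g has_derivative (\<lambda>h. \<alpha> * h + \<beta> * cnj h)) (at a)"
    by (simp add: conj_map_def[abs_def])
  show "(norm \<alpha>)\<^sup>2 - (norm \<beta>)\<^sup>2 = det A"
    unfolding \<alpha>_def \<beta>_def cmod_power2 det_2 complex.sel
    by (simp add: power2_eq_square field_simps)
qed

text \<open>On the circle \<open>g\<close> is closer to \<open>f\<close> than \<open>f\<close> is to
  \<open>0\<close>, so both wind equally often; inside, each zero of \<open>g\<close> contributes
  the sign of its Jacobian determinant. The sum is real-valued, so its integrality is recorded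
  separately.\<close>

lemma degree_approx_sum_eq_circ_wn:
  fixes f g :: "real^2 \<Rightarrow> real^2"
  assumes contf: "continuous_on UNIV f" and r: "r > 0" and nz: "\<And>x. norm x = r \<Longrightarrow> f x \<noteq> 0"
    and app: "degree_approx f (ball 0 r) 0 g"
  shows "of_real (\<Sum>x | x \<in> ball 0 r \<and> g x = 0. sgn (det (jacobian g (at x)))) = circ_wn (conj_map f) 0 r"
    and "(\<Sum>x | x \<in> ball 0 r \<and> g x = 0. sgn (det (jacobian g (at x)))) \<in> \<int>"
proof -
  define Z where "Z = {x. x \<in> ball 0 r \<and> g x = 0}"
  define J where "J = (\<lambda>x. det (jacobian g (at x)))"
  have contg: "continuous_on (cball 0 r) g" and c1: "C1_on (ball 0 r) g"
    and near: "\<And>x. norm x \<le> r \<Longrightarrow> dist (f x) (g x) < infdist 0 (f ` sphere 0 r)"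
    and reg: "\<And>x. x \<in> Z \<Longrightarrow> J x \<noteq> 0"
    using app r unfolding degree_approx_def Z_def J_def by auto
  have near': "norm (f x - g x) < norm (f x)" if "norm x = r" for x
  proof -
    have "infdist 0 (f ` sphere 0 r) \<le> dist 0 (f x)" by (rule infdist_le) (use that in auto)
    then show ?thesis using near[of x] that by (simp add: dist_norm)
  qed
  have gnz: "g x \<noteq> 0" if "norm x = r" for x using near'[OF that] by auto
  have contg': "continuous_on (cball 0 r) (conj_map g)"
    unfolding conj_map_def by (intro continuous_intros continuous_on_compose2[OF contg]) auto
  have D: "\<exists>\<alpha> \<beta>. (conj_map g has_derivative (\<lambda>h. \<alpha> * h + \<beta> * cnj h)) (at z) \<and>
      (norm \<alpha>)\<^sup>2 - (norm \<beta>)\<^sup>2 = J (of_complex z)" if "norm z < r" for z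
  proof -
    have "of_complex z \<in> ball 0 r" using that by simp
    moreover obtain g' where "\<forall>x\<in>ball 0 r. (g has_derivative blinfun_apply (g' x)) (at x)"
      using c1 unfolding C1_on_def by (elim exE conjE)
    ultimately have "(g has_derivative blinfun_apply (g' (of_complex z))) (at (of_complex z))" by (rule bspec[rotated])
    then obtain G where G: "(g has_derivative G) (at (of_complex z))" by (rule that)
    then have "jacobian g (at (of_complex z)) = matrix G"
      by (simp add: jacobian_def frechet_derivative_at[symmetric])
    then have "J (of_complex z) = det (matrix G)" by (simp add: J_def)
    then show ?thesis using conj_map_derivative[OF G] by (intro exI conjI) simp_all
  qed
  define S where "S = {z. norm z \<le> r \<and> conj_map g z = 0}"
  have S_eq: "S = to_complex ` Z"
  proof -
    have "z \<in> S \<longleftrightarrow> of_complex z \<in> Z" for z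
      unfolding S_def Z_def conj_map_def using gnz[of "of_complex z"] by (auto simp: order_le_less)
    moreover have "z \<in> to_complex ` Z \<longleftrightarrow> of_complex z \<in> Z" for z
      by (metis imageE imageI to_of_complex)
    ultimately show ?thesis by blast
  qed
  have Sr: "norm z < r" if "z \<in> S" for z using that unfolding S_eq Z_def by auto
  have ne: "norm \<alpha> \<noteq> norm \<beta>" if "z \<in> S" "(norm \<alpha>)\<^sup>2 - (norm \<beta>)\<^sup>2 = J (of_complex z)" for \<alpha> \<beta> :: complex and z
    using reg[of "of_complex z"] that unfolding S_eq by auto
  have "compact S"
  proof -
    have "S = cball 0 r \<inter> conj_map g -` {0}" by (auto simp: S_def)
    then show ?thesis
      by (simp add: compact_eq_bounded_closed bounded_Int continuous_closed_preimage[OF contg'])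
  qed
  \<comment> \<open>Regular zeros are isolated, which makes the compact zero set finite.\<close>
  moreover have "\<not> a islimpt S" if a: "a \<in> S" for a
  proof -
    obtain \<alpha> \<beta> where D': "(conj_map g has_derivative (\<lambda>h. \<alpha> * h + \<beta> * cnj h)) (at a)"
      "(norm \<alpha>)\<^sup>2 - (norm \<beta>)\<^sup>2 = J (of_complex a)" using D[OF Sr[OF a]] by blast
    have "conj_map g a = 0" using a by (simp add: S_def)
    from regular_zero[OF D'(1) this ne[OF a D'(2)]] obtain d where d: "d > 0" "\<And>x. 0 < norm (x - a) \<Longrightarrow> norm (x - a) < d \<Longrightarrow> 
       norm (conj_map g x - (\<alpha> * (x - a) + \<beta> * cnj (x - a))) < norm (\<alpha> * (x - a) + \<beta> * cnj (x - a))" by blast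
    have "x = a" if "x \<in> S" "dist x a < d" for x
    proof (rule ccontr)
      assume "x \<noteq> a"
      moreover have "conj_map g x = 0" using that by (simp add: S_def)
      ultimately show False
        using d(2)[of x] that(2) unfolding dist_norm by (metis diff_0 less_irrefl norm_minus_cancel zero_less_norm_iff right_minus_eq)
    qed
    then show ?thesis unfolding islimpt_approachable using d(1) by blast
  qed
  ultimately have S: "finite S" using finite_not_islimpt_in_compact[of S S] by simp
  have Z: "finite Z" using S finite_imageD[of to_complex Z] unfolding S_eq
    by (metis inj_on_inverseI to_of_complex(2))
  define w where "w = (\<lambda>z. if J (of_complex z) > 0 then 1 else -1 :: int)"
  have sgnw: "sgn (J (of_complex z)) = of_int (w z)" if "z \<in> S" for z
    using reg[of "of_complex z"] that unfolding S_eq by (auto simp: w_def sgn_if)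
  have "circ_wn (conj_map g) 0 r = of_int (\<Sum>z\<in>S. w z)"
  proof (rule circ_wn_eq_sum_disc[OF S _ r])
    show "S \<subseteq> ball 0 r" using Sr by auto
    show "continuous_on (cball 0 r - S) (conj_map g)" using contg' continuous_on_subset by blast
    show "conj_map g x \<noteq> 0" if "x \<in> cball 0 r - S" for x using that by (auto simp: S_def)
    fix a assume a: "a \<in> S"
    obtain \<alpha> \<beta> where D': "(conj_map g has_derivative (\<lambda>h. \<alpha> * h + \<beta> * cnj h)) (at a)"
      "(norm \<alpha>)\<^sup>2 - (norm \<beta>)\<^sup>2 = J (of_complex a)" using D[OF Sr[OF a]] by blast
    have "conj_map g a = 0" using a by (simp add: S_def)
    from circ_wn_regular_zero[OF D'(1) this ne[OF a D'(2)] open_ball[of 0 r]]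
    show "\<forall>\<^sub>F e in at_right 0. circ_wn (conj_map g) a e = of_int (w a)"
      using Sr[OF a] continuous_on_subset[OF contg' ball_subset_cball] sgnw[OF a] D'(2) by simp
  qed
  also have "(\<Sum>z\<in>S. w z) = (\<Sum>x\<in>Z. w (to_complex x))"
    unfolding S_eq by (rule sum.reindex_cong[OF _ refl refl]) (metis inj_on_inverseI to_of_complex(2))
  finally have eq: "circ_wn (conj_map g) 0 r = of_int (\<Sum>x\<in>Z. w (to_complex x))" .
  have "(\<Sum>x\<in>Z. sgn (J x)) = (\<Sum>x\<in>Z. of_int (w (to_complex x)))"
    by (rule sum.cong[OF refl]) (use sgnw[of "to_complex _"] S_eq in force)
  then have sum: "(\<Sum>x\<in>Z. sgn (J x)) = of_int (\<Sum>x\<in>Z. w (to_complex x))" by simp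
  have "circ_wn (conj_map g) 0 r = circ_wn (conj_map f) 0 r"
  proof (rule circ_wn_linear)
    show "continuous_on (sphere 0 r) (conj_map g)" using contg' sphere_cball continuous_on_subset by blast
    show "continuous_on (sphere 0 r) (conj_map f)"
      unfolding conj_map_def by (intro continuous_intros continuous_on_compose2[OF contf]) auto
    fix z :: complex assume "z \<in> sphere 0 r"
    then have "norm (to_complex (f (of_complex z) - g (of_complex z))) < norm (to_complex (f (of_complex z)))"
      using near'[of "of_complex z"] unfolding norm_to_complex by simp
    then have "norm (conj_map g z - conj_map f z) < norm (conj_map f z)"
      unfolding conj_map_def to_complex_simps by (simp add: norm_minus_commute)
    then show "0 \<notin> closed_segment (conj_map g z) (conj_map f z)" by (rule not_in_segment_if_near)
  qed (use r in auto)
  then have "of_real (\<Sum>x\<in>Z. sgn (J x)) = circ_wn (conj_map f) 0 r" unfolding sum eq[symmetric] by (simp add: eq)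
  then show "of_real (\<Sum>x | x \<in> ball 0 r \<and> g x = 0. sgn (det (jacobian g (at x)))) = circ_wn (conj_map f) 0 r"
    unfolding Z_def J_def .
  have "(\<Sum>x\<in>Z. sgn (J x)) \<in> \<int>" unfolding sum by (rule Ints_of_int)
  then show "(\<Sum>x | x \<in> ball 0 r \<and> g x = 0. sgn (det (jacobian g (at x)))) \<in> \<int>"
    unfolding Z_def J_def .
qed

section \<open>Existence of regular approximations\<close>

lemma C1_on_real_polynomial_function:
  fixes p :: "'a::euclidean_space \<Rightarrow> real"
  assumes "real_polynomial_function p"
  shows "\<exists>p' :: 'a \<Rightarrow> 'a \<Rightarrow>\<^sub>L real.
    (\<forall>x. (p has_derivative blinfun_apply (p' x)) (at x)) \<and> continuous_on UNIV p'"
  using assms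
proof (induction p rule: real_polynomial_function.induct)
  case (linear h)
  then show ?case
    by (intro exI[of _ "\<lambda>_. Blinfun h"]) (simp add: bounded_linear_Blinfun_apply bounded_linear_imp_has_derivative)
next
  case (const c)
  show ?case by (intro exI[of _ "\<lambda>_. 0"]) simp
next
  case (add p q)
  then obtain p' q' :: "'a \<Rightarrow> 'a \<Rightarrow>\<^sub>L real" where
    "\<And>x. (p has_derivative blinfun_apply (p' x)) (at x)" "continuous_on UNIV p'"
    "\<And>x. (q has_derivative blinfun_apply (q' x)) (at x)" "continuous_on UNIV q'" by auto
  then show ?case
    by (intro exI[of _ "\<lambda>x. p' x + q' x"])
       (auto simp: plus_blinfun.rep_eq intro!: has_derivative_add continuous_intros)
next
  case (mult p q)
  then obtain p' q' :: "'a \<Rightarrow> 'a \<Rightarrow>\<^sub>L real" where *: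
    "\<And>x. (p has_derivative blinfun_apply (p' x)) (at x)" "continuous_on UNIV p'"
    "\<And>x. (q has_derivative blinfun_apply (q' x)) (at x)" "continuous_on UNIV q'" by auto
  have "continuous_on UNIV p" "continuous_on UNIV q"
    using has_derivative_continuous[OF *(1)] has_derivative_continuous[OF *(3)]
    by (simp_all add: continuous_at_imp_continuous_on)
  then have C: "continuous_on UNIV (\<lambda>x. p x *\<^sub>R q' x + q x *\<^sub>R p' x)"
    using * by (intro continuous_intros)
  have D: "((\<lambda>x. p x * q x) has_derivative blinfun_apply (p x *\<^sub>R q' x + q x *\<^sub>R p' x)) (at x)" for x
    using has_derivative_mult[OF *(1,3), of x]
    by (simp add: plus_blinfun.rep_eq scaleR_blinfun.rep_eq mult_ac)
  show ?case
    by (intro exI[of _ "\<lambda>x. p x *\<^sub>R q' x + q x *\<^sub>R p' x"] conjI allI D C)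
qed

lemma C1_on_polynomial_function:
  fixes g :: "'a::euclidean_space \<Rightarrow> 'b::euclidean_space"
  assumes "polynomial_function g"
  shows "C1_on U g"
proof -
  have "\<exists>p' :: 'a \<Rightarrow> 'a \<Rightarrow>\<^sub>L real. (\<forall>x. ((\<lambda>x. g x \<bullet> b) has_derivative blinfun_apply (p' x)) (at x)) \<and> continuous_on UNIV p'"
    if b: "b \<in> Basis" for b
  proof -
    have "real_polynomial_function (\<lambda>x. g x \<bullet> b)" using assms b polynomial_function_iff_Basis_inner by blast
    then show ?thesis by (rule C1_on_real_polynomial_function)
  qed
  then obtain p' :: "'b \<Rightarrow> 'a \<Rightarrow> 'a \<Rightarrow>\<^sub>L real" where p': 
    "\<And>b x. b \<in> Basis \<Longrightarrow> ((\<lambda>x. g x \<bullet> b) has_derivative blinfun_apply (p' b x)) (at x)"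
    "\<And>b. b \<in> Basis \<Longrightarrow> continuous_on UNIV (p' b)" by metis
  define g' where "g' = (\<lambda>x. \<Sum>b\<in>Basis. blinfun_scaleR_left b o\<^sub>L p' b x)"
  have app: "blinfun_apply (g' x) h = (\<Sum>b\<in>Basis. blinfun_apply (p' b x) h *\<^sub>R b)" for x h
    by (simp add: g'_def blinfun.sum_left)
  have "((\<lambda>x. \<Sum>b\<in>Basis. (g x \<bullet> b) *\<^sub>R b) has_derivative (\<lambda>h. \<Sum>b\<in>Basis. blinfun_apply (p' b x) h *\<^sub>R b)) (at x)" for x
    by (intro has_derivative_sum has_derivative_scaleR_left p'(1))
  then have "(g has_derivative blinfun_apply (g' x)) (at x)" for x
    unfolding euclidean_representation app[abs_def, symmetric] by simp
  moreover have "continuous_on UNIV g'"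
    unfolding g'_def
    by (intro continuous_on_sum bounded_bilinear.continuous_on[OF bounded_bilinear_blinfun_compose] continuous_on_const p'(2))
  ultimately show ?thesis
    unfolding C1_on_def by (intro exI[of _ g'] conjI ballI) (auto intro: continuous_on_subset)
qed

text \<open>Weierstrass gives a polynomial map within half the permitted distance; by Sard some
  vector of length below the other half is not a critical value, and subtracting it makes
  \<open>0\<close> a regular value.\<close>

lemma degree_approx_exists:
  fixes f :: "real^2 \<Rightarrow> real^2"
  assumes contf: "continuous_on UNIV f" and r: "r > 0" and nz: "\<And>x. norm x = r \<Longrightarrow> f x \<noteq> 0"
  shows "\<exists>g. degree_approx f (ball 0 r) 0 g"
proof -
  define e where "e = infdist 0 (f ` sphere 0 r)"
  have "compact (f ` sphere 0 r)" using contf by (intro compact_continuous_image continuous_on_subset[OF contf]) auto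
  moreover have "sphere (0::real^2) r \<noteq> {}" using r by simp
  ultimately have e: "e > 0"
    using nz by (auto simp: e_def intro!: infdist_pos_not_in_closed compact_imp_closed)
  then obtain g where g: "polynomial_function g" "\<And>x. x \<in> cball 0 r \<Longrightarrow> norm (f x - g x) < e / 2"
    using Stone_Weierstrass_polynomial_function[OF compact_cball continuous_on_subset[OF contf], of 0 r "e/2"] by auto
  have D: "(g has_derivative (frechet_derivative g (at x))) (at x)" for x
    using differentiable_at_polynomial_function[OF g(1)] frechet_derivative_works by blast
  define S where "S = {x. det (jacobian g (at x)) = 0}"
  have "negligible (g ` S)"
  proof (rule baby_Sard)
    fix x assume x: "x \<in> S"
    show "(g has_derivative (frechet_derivative g (at x))) (at x within S)"
      using D has_derivative_at_withinI by blast
    show "rank (matrix (frechet_derivative g (at x))) < CARD(2)"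
      using x det_eq_0_rank[of "matrix (frechet_derivative g (at x))"] by (simp add: S_def jacobian_def)
  qed simp
  moreover have "\<not> negligible (ball (0::real^2) (e / 2))"
    using e open_not_negligible[of "ball (0::real^2) (e / 2)"] by auto
  ultimately obtain v where v: "v \<in> ball 0 (e / 2)" "v \<notin> g ` S"
    using negligible_subset by blast
  define g1 where "g1 = (\<lambda>x. g x - v)"
  have g1: "polynomial_function g1" unfolding g1_def using g(1) by auto
  have "((\<lambda>x. g x - v) has_derivative (frechet_derivative g (at x))) (at x)" for x
    using has_derivative_diff[OF D has_derivative_const[of v]] by simp
  then have J: "jacobian g1 (at x) = jacobian g (at x)" for x
    unfolding jacobian_def g1_def by (metis frechet_derivative_at)
  have "degree_approx f (ball 0 r) 0 g1"
    unfolding degree_approx_def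
  proof (intro conjI ballI impI)
    show "continuous_on (closure (ball 0 r)) g1"
      using g1 continuous_on_polymonial_function by blast
    show "C1_on (ball 0 r) g1" by (rule C1_on_polynomial_function[OF g1])
    show "dist (f x) (g1 x) < infdist 0 (f ` frontier (ball 0 r))" if "x \<in> closure (ball 0 r)" for x
    proof -
      have "norm (f x - g x + v) \<le> norm (f x - g x) + norm v" by (rule norm_triangle_ineq)
      moreover have "norm (f x - g x) < e / 2" using g(2)[of x] that r by simp
      ultimately show ?thesis using v(1) r by (simp add: dist_norm g1_def e_def algebra_simps)
    qed
    show "det (jacobian g1 (at x)) \<noteq> 0" if "x \<in> ball 0 r" "g1 x = 0" for x
      using v(2) that unfolding J by (auto simp: g1_def S_def)
  qed
  then show ?thesis by blast
qed

text \<open>Beyond the zeros of \<open>f\<close> the winding number is independent of the radius, so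
  any ball that \<open>SOME\<close> may choose gives the same value; all approximations have the
  same signed sum, which determines the \<open>THE\<close>.\<close>

lemma deg_eq_circ_wn:
  fixes f :: "real^2 \<Rightarrow> real^2"
  assumes contf: "continuous_on UNIV f" and r: "r > 0" and nz: "\<And>x. norm x \<ge> r \<Longrightarrow> f x \<noteq> 0"
  shows "of_int (deg f) = circ_wn (conj_map f) 0 r"
proof -
  define s where "s = (SOME R. R > 0 \<and> f -` {0} \<subseteq> ball 0 R)"
  have "\<exists>R. R > 0 \<and> f -` {0} \<subseteq> ball 0 R"
    using r nz by (intro exI[of _ r]) (auto simp: not_le[symmetric])
  from someI_ex[OF this] have s: "s > 0" "f -` {0} \<subseteq> ball 0 s" unfolding s_def by blast+
  have nzs: "f x \<noteq> 0" if "norm x \<ge> s" for x using s(2) that by fastforce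
  have cont: "continuous_on T (conj_map f)" for T
    unfolding conj_map_def by (intro continuous_intros continuous_on_compose2[OF contf]) auto
  have "circ_wn (conj_map f) 0 t = circ_wn (conj_map f) 0 (max r s)" if "t = r \<or> t = s" for t
    by (rule circ_wn_scale) (use that r s(1) nz nzs cont in \<open>auto simp: conj_map_def\<close>)
  from this[of r] this[of s] have rs: "circ_wn (conj_map f) 0 r = circ_wn (conj_map f) 0 s" by simp
  define \<Sigma> :: "(real^2 \<Rightarrow> real^2) \<Rightarrow> real" where 
    "\<Sigma> = (\<lambda>g. \<Sum>x | x \<in> ball 0 s \<and> g x = 0. sgn (det (jacobian g (at x))))"
  have sum: "of_real (\<Sigma> g) = circ_wn (conj_map f) 0 s" "\<Sigma> g \<in> \<int>" if "degree_approx f (ball 0 s) 0 g" for g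
    using degree_approx_sum_eq_circ_wn[OF contf s(1) _ that] nzs unfolding \<Sigma>_def by auto
  obtain g where g: "degree_approx f (ball 0 s) 0 g"
    using degree_approx_exists[OF contf s(1)] nzs by auto
  obtain d where d: "\<Sigma> g = of_int d" using sum(2)[OF g] by (elim Ints_cases)
  have "deg f = (THE d. \<exists>g. degree_approx f (ball 0 s) 0 g \<and> of_int d = \<Sigma> g)"
    unfolding deg_def brouwer_degree_def s_def[symmetric] \<Sigma>_def ..
  also have "\<dots> = d"
  proof (rule the_equality)
    show "\<exists>g. degree_approx f (ball 0 s) 0 g \<and> of_int d = \<Sigma> g" using g d by auto
    fix d' assume "\<exists>g. degree_approx f (ball 0 s) 0 g \<and> of_int d' = \<Sigma> g"
    then obtain g' where "degree_approx f (ball 0 s) 0 g'" "of_int d' = \<Sigma> g'" by blast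
    then have "complex_of_real (of_int d') = of_real (of_int d)" using sum(1) g d by metis
    then show "d' = d" by simp
  qed
  finally have "of_int (deg f) = complex_of_real (\<Sigma> g)" by (simp add: d)
  then show ?thesis using sum(1)[OF g] rs by simp
qed

section \<open>Discrete gradient flow\<close>

locale steep_gradient =
  fixes \<phi> :: "complex \<Rightarrow> real" and f :: "complex \<Rightarrow> complex" and R M :: real
  assumes grad: "\<And>x. (\<phi> has_derivative (\<lambda>h. f x \<bullet> h)) (at x)"
    and contf: "continuous_on UNIV f"
    and R: "R > 0"
    and steep: "\<And>x. norm x \<ge> R \<Longrightarrow> norm (f x) \<ge> 2"
    and M: "\<And>x. norm x \<le> R + 1 \<Longrightarrow> \<bar>\<phi> x\<bar> \<le> M"
begin

lemma cont_phi: "continuous_on S \<phi>"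
  by (meson continuous_at_imp_continuous_on grad has_derivative_continuous)

lemma dual: "steep_gradient (\<lambda>x. - \<phi> x) (\<lambda>x. - f x) R M"
proof
  show "((\<lambda>x. - \<phi> x) has_derivative (\<lambda>h. - f x \<bullet> h)) (at x)" for x
    using has_derivative_minus[OF grad[of x]] by (simp add: inner_minus_left)
qed (use contf R steep M in \<open>auto intro!: continuous_intros\<close>)

text \<open>\<open>F\<close> iterates one Euler step that is switched off on
  \<open>cball 0 R\<close> and from level \<open>L + 1\<close> on. Every step raises
  \<open>\<phi>\<close> by at least its length, so an orbit ending below \<open>L\<close> must have
  visited \<open>cball 0 (R + 1)\<close>, and its drift from there is bounded by the remaining gain.
  The polygon through the orbit is the connected set \<open>C\<close>.\<close>

lemma flow:
  assumes "\<rho> \<ge> 0"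
  obtains F :: "complex \<Rightarrow> complex" where "continuous_on UNIV F"
    and "\<And>x. norm x \<le> R \<Longrightarrow> F x = x"
    and "\<And>x. norm x \<le> \<rho> \<Longrightarrow> \<phi> (F x) < L \<Longrightarrow> 
          \<exists>y. norm y \<le> R + 1 \<and> \<phi> x \<le> \<phi> y \<and> norm (F x - y) \<le> \<phi> (F x) - \<phi> y"
    and "\<And>x. norm x \<le> \<rho> \<Longrightarrow> \<exists>C. connected C \<and> x \<in> C \<and> F x \<in> C \<and> C \<subseteq> {z. \<phi> x \<le> \<phi> z}"
    and "\<And>x. R < norm x \<Longrightarrow> norm x \<le> \<rho> \<Longrightarrow> \<phi> x < L + 1 \<Longrightarrow> \<phi> x < \<phi> (F x)"
    and "\<And>r. R < r \<Longrightarrow> r \<le> \<rho> \<Longrightarrow> (\<And>x. norm x = r \<Longrightarrow> \<phi> x < L + 1) \<Longrightarrow>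
          circ_wn (\<lambda>x. x - F x) 0 r = circ_wn f 0 r"
proof -
  have "cball (0::complex) \<rho> \<noteq> {}" using assms by simp
  then obtain x0 where "\<forall>x\<in>cball 0 \<rho>. \<phi> x0 \<le> \<phi> x"
    using continuous_attains_inf[OF compact_cball _ cont_phi] by blast
  then obtain A where A: "\<And>x. norm x \<le> \<rho> \<Longrightarrow> A \<le> \<phi> x" by (metis mem_cball_0)
  \<comment> \<open>\<open>B\<close> bounds the displacement of every orbit starting in \<open>cball 0 \<rho>\<close>: steps stop once \<open>\<phi>\<close> reaches \<open>L + 1\<close>,
    and \<open>\<phi>\<close> gains at least the length of each step.\<close>
  define B where "B = max 0 (L + 1 - A) + 1"
  have B: "B \<ge> 1" "B \<ge> L + 1 - A + 1" by (auto simp: B_def)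
  have "uniformly_continuous_on (cball 0 (\<rho> + B + 1)) f"
    by (intro compact_uniformly_continuous continuous_on_subset[OF contf]) auto
  then obtain d0 where d0: "d0 > 0"
    "\<And>x y. x \<in> cball 0 (\<rho> + B + 1) \<Longrightarrow> y \<in> cball 0 (\<rho> + B + 1) \<Longrightarrow> dist y x < d0 \<Longrightarrow> dist (f y) (f x) < 1"
    unfolding uniformly_continuous_on_def by (metis zero_less_one)
  \<comment> \<open>Being below \<open>d0\<close> keeps the change of \<open>f\<close> along a step
    below \<open>1\<close>; being at most \<open>1\<close> keeps the step inside the ball of radius
    \<open>\<rho> + B + 1\<close>.\<close>
  define d where "d = min (d0 / 2) 1"
  have d: "0 < d" "d < d0" "d \<le> 1" using d0(1) by (auto simp: d_def)
  \<comment> \<open>\<open>max 2\<close> makes the normalisation continuous across zeros of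
    \<open>f\<close>; where \<open>norm x \<ge> R\<close> it yields unit vectors by
    \<open>steep\<close>.\<close>
  define u where "u = (\<lambda>x. inverse (max 2 (norm (f x))) *\<^sub>R f x)"
  define a where "a = (\<lambda>x. min 1 (max 0 (norm x - R)) * min 1 (max 0 (L + 1 - \<phi> x)))"
  define E where "E = (\<lambda>x. x + (d * a x) *\<^sub>R u x)"
  have a01: "0 \<le> a x" "a x \<le> 1" for x
    unfolding a_def by (auto intro!: mult_nonneg_nonneg mult_le_one)
  have apos: "a x > 0 \<longleftrightarrow> norm x > R \<and> \<phi> x < L + 1" for x
    unfolding a_def by (auto simp: zero_less_mult_iff min_def max_def)
  have azero: "a x = 0 \<or> norm x > R \<and> \<phi> x < L + 1" for x
    using apos[of x] a01(1)[of x] by linarith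
  have contE: "continuous_on S E" for S
    unfolding E_def a_def u_def
    by (intro continuous_intros continuous_on_subset[OF contf] cont_phi) auto
  have u1: "norm (u x) = 1" "f x \<bullet> u x = norm (f x)" if "norm x \<ge> R" for x
  proof -
    have f2: "norm (f x) \<ge> 2" using steep[OF that] .
    then have nz: "f x \<noteq> 0" by auto
    then show "norm (u x) = 1" using f2 by (simp add: u_def max_def)
    show "f x \<bullet> u x = norm (f x)"
      using f2 nz by (simp add: u_def max_def dot_square_norm power2_eq_square)
  qed
  \<comment> \<open>Along the segment the derivative of \<open>\<phi>\<close> is at least
    \<open>norm (f y) - 1 \<ge> 1\<close>, so \<open>\<phi>\<close> gains at least the length
    travelled.\<close>
  have seg: "\<phi> (y + s *\<^sub>R u y) \<ge> \<phi> y + s" 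
    if y: "norm y \<le> \<rho> + B" "norm y \<ge> R" and s: "0 \<le> s" "s \<le> d" for y s
  proof -
    define g where "g = (\<lambda>t. \<phi> (y + t *\<^sub>R u y) - t)"
    have "g 0 \<le> g s"
    proof (rule DERIV_nonneg_imp_nondecreasing[OF s(1)])
      fix t assume t: "0 \<le> t" "t \<le> s"
      let ?z = "y + t *\<^sub>R u y"
      have "(\<phi> \<circ> (\<lambda>t. y + t *\<^sub>R u y) has_derivative (\<lambda>h. f ?z \<bullet> h) \<circ> (\<lambda>t. t *\<^sub>R u y)) (at t)"
        by (rule diff_chain_at) (auto intro!: derivative_eq_intros grad)
      then have "((\<lambda>t. \<phi> (y + t *\<^sub>R u y)) has_real_derivative (f ?z \<bullet> u y)) (at t)"
        by (simp add: has_field_derivative_def o_def mult_commute_abs)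
      then have D: "(g has_real_derivative (f ?z \<bullet> u y - 1)) (at t)"
        unfolding g_def by (auto intro!: derivative_eq_intros)
      have n: "norm (?z - y) \<le> d" using t s u1(1)[OF y(2)] by simp
      have "norm ?z \<le> \<rho> + B + 1"
        using norm_triangle_ineq[of y "t *\<^sub>R u y"] n y(1) d(3) by simp
      then have "dist (f ?z) (f y) < 1"
        using n y(1) d by (intro d0(2)) (auto simp: dist_norm[of "?z" y])
      then have "\<bar>(f ?z - f y) \<bullet> u y\<bar> \<le> 1 * 1"
        using Cauchy_Schwarz_ineq2[of "f ?z - f y" "u y"] u1(1)[OF y(2)] by (simp add: dist_norm)
      then have "f ?z \<bullet> u y \<ge> 1"
        using u1(2)[OF y(2)] steep[OF y(2)] by (simp add: inner_diff_left)
      then show "\<exists>D. (g has_real_derivative D) (at t) \<and> 0 \<le> D" using D by force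
    qed
    then show ?thesis by (simp add: g_def)
  qed
  have step: "norm (E y - y) = d * a y" "norm (E y - y) \<le> \<phi> (E y) - \<phi> y"
      "\<And>z. z \<in> closed_segment y (E y) \<Longrightarrow> \<phi> z \<ge> \<phi> y"
    if y: "norm y \<le> \<rho> + B" for y
  proof -
    show 1: "norm (E y - y) = d * a y"
      using azero[of y] a01[of y] d(1) u1(1)[of y] by (auto simp: E_def)
    have da: "0 \<le> d * a y" "d * a y \<le> d" using a01[of y] d(1) by (auto simp: mult_left_le)
    show "norm (E y - y) \<le> \<phi> (E y) - \<phi> y"
      using seg[OF y _ da] azero[of y] unfolding 1 by (auto simp: E_def)
    fix z assume "z \<in> closed_segment y (E y)"
    then obtain t where t: "0 \<le> t" "t \<le> 1" "z = y + t *\<^sub>R (E y - y)"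
      by (auto simp: in_segment algebra_simps)
    have z: "z = y + (t * (d * a y)) *\<^sub>R u y" unfolding t(3) by (simp add: E_def)
    have "0 \<le> t * (d * a y)" "t * (d * a y) \<le> d"
      using da t mult_left_le_one_le[of "d * a y" t] by auto
    then show "\<phi> z \<ge> \<phi> y"
      using seg[OF y, of "t * (d * a y)"] azero[of y] z by (cases "a y = 0") auto
  qed
  \<comment> \<open>Both bounds are proved together, since the displacement bound keeps the orbit in
    the ball where \<open>step\<close> applies. A step that moves starts below level
    \<open>L + 1\<close>, hence at distance at most \<open>B - 1\<close>, and adds at most
    \<open>1\<close>.\<close>
  have inv: "norm ((E ^^ j) x - x) \<le> \<phi> ((E ^^ j) x) - \<phi> x \<and> norm ((E ^^ j) x - x) \<le> B"
    if x: "norm x \<le> \<rho>" for x j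
  proof (induction j)
    case 0 show ?case using B by simp
  next
    case (Suc j)
    let ?y = "(E ^^ j) x"
    have y: "norm ?y \<le> \<rho> + B" using Suc x norm_triangle_sub[of ?y x] by linarith
    have tri: "norm (E ?y - x) \<le> norm (E ?y - ?y) + norm (?y - x)"
      by (metis add.commute diff_add_cancel norm_triangle_ineq add_diff_eq)
    have 1: "norm (E ?y - x) \<le> \<phi> (E ?y) - \<phi> x" using tri step(2)[OF y] Suc by linarith
    have "norm (E ?y - x) \<le> B"
    proof (cases "a ?y = 0")
      case True then show ?thesis using Suc by (simp add: E_def)
    next
      case False
      then have "\<phi> ?y < L + 1" using azero[of ?y] by auto
      then have "norm (?y - x) \<le> B - 1" using Suc A[OF x] B by linarith
      moreover have "norm (E ?y - ?y) \<le> 1"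
        unfolding step(1)[OF y] using d a01[of ?y] by (simp add: mult_le_one)
      ultimately show ?thesis using tri by linarith
    qed
    then show ?case using 1 by simp
  qed
  have bnd: "norm ((E ^^ j) x) \<le> \<rho> + B" if "norm x \<le> \<rho>" for x j
    using inv[OF that, of j] that norm_triangle_sub[of "(E ^^ j) x" x] by linarith
  have mono: "norm ((E ^^ j) x - (E ^^ i) x) \<le> \<phi> ((E ^^ j) x) - \<phi> ((E ^^ i) x)"
    if "norm x \<le> \<rho>" "i \<le> j" for x i j
    using that(2)
  proof (induction j rule: dec_induct)
    case base show ?case by simp
  next
    case (step j)
    have "norm (E ((E ^^ j) x) - (E ^^ i) x) \<le> norm (E ((E ^^ j) x) - (E ^^ j) x) + norm ((E ^^ j) x - (E ^^ i) x)"
      by (metis add.commute diff_add_cancel norm_triangle_ineq add_diff_eq)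
    then show ?case using step.IH \<open>norm x \<le> \<rho>\<close> bnd[of x j] \<open>\<And>y. norm y \<le> \<rho> + B \<Longrightarrow> norm (E y - y) \<le> \<phi> (E y) - \<phi> y\<close>[of "(E ^^ j) x"]
      by simp
  qed
  have mono': "\<phi> ((E ^^ i) x) \<le> \<phi> ((E ^^ j) x)" if "norm x \<le> \<rho>" "i \<le> j" for x i j
    using mono[OF that] norm_ge_zero[of "(E ^^ j) x - (E ^^ i) x"] by linarith
  \<comment> \<open>From the lower bound \<open>A\<close>, \<open>n\<close> full steps climb to
    level \<open>L\<close>; at least one step gives strict growth of \<open>\<phi>\<close>.\<close>
  obtain n where n: "real n * d \<ge> L - A" "n \<ge> 1"
  proof -
    obtain n where "L - A < real n * d" using reals_Archimedean3[OF d(1)] by blast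
    moreover have "real n * d \<le> real (Suc n) * d" using d(1) by simp
    ultimately show ?thesis using that[of "Suc n"] by simp
  qed
  have incr: "\<phi> x < \<phi> ((E ^^ j) x)" if "R < norm x" "norm x \<le> \<rho>" "\<phi> x < L + 1" "j \<ge> 1" for x j
  proof -
    have y: "norm x \<le> \<rho> + B" using that B by linarith
    have "a x > 0" using apos that by blast
    then have "\<phi> x < \<phi> (E x)" using step(1,2)[OF y] d(1) by (smt (verit) mult_pos_pos)
    then show ?thesis using mono'[OF that(2,4)] by simp
  qed
  have contEn: "continuous_on S (E ^^ j)" for j S
  proof (induction j)
    case (Suc j)
    then show ?case using continuous_on_compose[OF Suc contE] by simp
  qed (auto simp: id_def)
  show ?thesis
  proof (rule that[of "E ^^ n"])
    show "continuous_on UNIV (E ^^ n)" by (rule contEn)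
    show "(E ^^ n) x = x" if "norm x \<le> R" for x :: complex
    proof (induction n)
      case (Suc n) then show ?case using azero[of x] that by (auto simp: E_def)
    qed simp
  next
    fix x :: complex assume x: "norm x \<le> \<rho>" and L: "\<phi> ((E ^^ n) x) < L"
    \<comment> \<open>An orbit that stays outside \<open>cball 0 (R + 1)\<close> and below
      \<open>L\<close> takes full steps of length \<open>d\<close>, and by the choice of
      \<open>n\<close> it would reach \<open>L\<close>.\<close>
    have "\<exists>j\<le>n. norm ((E ^^ j) x) \<le> R + 1"
    proof (rule ccontr)
      assume "\<not> ?thesis"
      then have far: "norm ((E ^^ j) x) > R + 1" if "j \<le> n" for j using that by force
      have "A + real j * d \<le> \<phi> ((E ^^ j) x)" if "j \<le> n" for j
        using that
      proof (induction j)
        case 0 then show ?case using A[OF x] by simp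
      next
        case (Suc j)
        let ?y = "(E ^^ j) x"
        have "\<phi> ?y < L" using mono'[OF x, of j n] Suc.prems L by simp
        then have "a ?y = 1" using far[of j] Suc.prems by (simp add: a_def)
        then have "d \<le> \<phi> (E ?y) - \<phi> ?y" using step(1,2)[OF bnd[OF x, of j]] by simp
        then show ?case using Suc by (simp add: algebra_simps)
      qed
      from this[of n] show False using n L by simp
    qed
    then obtain j where j: "j \<le> n" "norm ((E ^^ j) x) \<le> R + 1" by blast
    then show "\<exists>y. norm y \<le> R + 1 \<and> \<phi> x \<le> \<phi> y \<and> norm ((E ^^ n) x - y) \<le> \<phi> ((E ^^ n) x) - \<phi> y"
      using mono[OF x j(1)] mono'[OF x, of 0 j] by (intro exI[of _ "(E ^^ j) x"]) auto
  next
    fix x :: complex assume x: "norm x \<le> \<rho>"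
    show "\<exists>C. connected C \<and> x \<in> C \<and> (E ^^ n) x \<in> C \<and> C \<subseteq> {z. \<phi> x \<le> \<phi> z}"
    proof (induction n)
      case 0 then show ?case by (intro exI[of _ "{x}"]) auto
    next
      case (Suc n)
      then obtain C where C: "connected C" "x \<in> C" "(E ^^ n) x \<in> C" "C \<subseteq> {z. \<phi> x \<le> \<phi> z}" by blast
      let ?S = "closed_segment ((E ^^ n) x) (E ((E ^^ n) x))"
      have "connected (C \<union> ?S)"
        using C by (intro connected_Un) auto
      moreover have "?S \<subseteq> {z. \<phi> x \<le> \<phi> z}"
        using step(3)[OF bnd[OF x, of n]] mono'[OF x, of 0 n] by fastforce
      ultimately show ?case using C by (intro exI[of _ "C \<union> ?S"]) auto
    qed
  next
    fix x :: complex assume "R < norm x" "norm x \<le> \<rho>" "\<phi> x < L + 1"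
    then show "\<phi> x < \<phi> ((E ^^ n) x)" using incr n by blast
  next
    fix r assume r: "R < r" "r \<le> \<rho>" and lt: "\<And>x::complex. norm x = r \<Longrightarrow> \<phi> x < L + 1"
    have r0: "r \<ge> 0" using r R by simp
    have "circ_wn (\<lambda>x. x - (E ^^ j) x) 0 r = circ_wn f 0 r" if "j \<ge> 1" for j
      using that
    proof (induction j rule: dec_induct)
      case base
      \<comment> \<open>One step moves \<open>x\<close> by a positive multiple of
        \<open>f x\<close>, so \<open>x - E x\<close> is \<open>f x\<close> times a negative real
        factor, and that factor deforms to \<open>-1\<close>.\<close>
      define c where "c = (\<lambda>x. - (d * a x * inverse (max 2 (norm (f x)))))"
      have c: "c x < 0" if "norm x = r" for x
      proof -
        have "0 < d * a x" using apos[of x] lt[OF that] that r d(1) by simp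
        moreover have "0 < inverse (max 2 (norm (f x)))" by simp
        ultimately show ?thesis unfolding c_def by (simp only: mult_pos_pos neg_less_0_iff_less)
      qed
      have cc: "continuous_on (sphere 0 r) c"
        unfolding c_def a_def by (intro continuous_intros continuous_on_subset[OF contf] cont_phi) auto
      have "circ_wn (\<lambda>x. x - (E ^^ 1) x) 0 r = circ_wn (\<lambda>x. of_real (c x) * f x) 0 r"
        by (rule circ_wn_cong) (use r0 in \<open>auto simp: E_def u_def c_def scaleR_conv_of_real\<close>)
      also have "\<dots> = circ_wn (\<lambda>x. of_real (c x)) 0 r + circ_wn f 0 r"
      proof (rule circ_wn_mult)
        show "f x \<noteq> 0" if "x \<in> sphere 0 r" for x using steep[of x] that r by auto
      qed (use r0 c cc in \<open>force intro!: continuous_intros continuous_on_subset[OF contf]\<close>)+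
      also have "circ_wn (\<lambda>x. of_real (c x)) 0 r = circ_wn (\<lambda>x. -1) 0 r"
      proof (rule circ_wn_linear)
        fix x :: complex assume "x \<in> sphere 0 r"
        then have "c x < 0" using c by simp
        then show "0 \<notin> closed_segment (complex_of_real (c x)) (- 1)"
          using closed_segment_of_real[of "c x" "-1", where ?'a = complex]
          by (auto simp: closed_segment_eq_real_ivl)
      qed (use r0 cc in \<open>auto intro!: continuous_intros\<close>)
      also have "\<dots> = 0" by (rule circ_wn_disc) (use r0 in auto)
      finally show ?case by simp
    next
      case (step j)
      \<comment> \<open>The segment from one iterate to the next misses \<open>x\<close>, because
        \<open>\<phi>\<close> on it is at least its value at iterate \<open>j \<ge> 1\<close>, which
        exceeds \<open>\<phi> x\<close>.\<close>
      have "circ_wn (\<lambda>x. x - (E ^^ j) x) 0 r = circ_wn (\<lambda>x. x - (E ^^ Suc j) x) 0 r"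
      proof (rule circ_wn_linear[OF r0])
        show "continuous_on (sphere 0 r) (\<lambda>x. x - (E ^^ j) x)" "continuous_on (sphere 0 r) (\<lambda>x. x - (E ^^ Suc j) x)"
          by (intro continuous_intros contEn)+
        fix x :: complex assume "x \<in> sphere 0 r"
        then have x: "norm x = r" by simp
        then have x': "norm x \<le> \<rho>" using r by simp
        show "0 \<notin> closed_segment (x - (E ^^ j) x) (x - (E ^^ Suc j) x)"
        proof
          assume "0 \<in> closed_segment (x - (E ^^ j) x) (x - (E ^^ Suc j) x)"
          then have "x \<in> closed_segment ((E ^^ j) x) (E ((E ^^ j) x))"
            by (auto simp: in_segment algebra_simps)
          then have "\<phi> ((E ^^ j) x) \<le> \<phi> x" using \<open>\<And>y z. norm y \<le> \<rho> + B \<Longrightarrow> z \<in> closed_segment y (E y) \<Longrightarrow> \<phi> y \<le> \<phi> z\<close> bnd[OF x'] by blast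
          then show False using incr[OF _ x' lt[OF x] step(1)] x r by simp
        qed
      qed
      then show ?case using step by simp
    qed
    then show "circ_wn (\<lambda>x. x - (E ^^ n) x) 0 r = circ_wn f 0 r" using n by blast
  qed
qed

end

section \<open>The winding number of a proper gradient\<close>

text \<open>Components of an open set are open, so contractions chosen separately on each of them
  glue to a continuous \<open>H\<close>, whose end map \<open>q\<close> is constant on
  components.\<close>

lemma contract_components:
  fixes W :: "'a::euclidean_space set"
  assumes W: "open W" and contr: "\<forall>U\<in>components W. contractible U"
  obtains H :: "real \<times> 'a \<Rightarrow> 'a" and q where "continuous_on ({0..1} \<times> W) H"
    "\<And>x. x \<in> W \<Longrightarrow> H (0, x) = x" "\<And>x. x \<in> W \<Longrightarrow> H (1, x) = q x"
    "\<And>t x. t \<in> {0..1} \<Longrightarrow> x \<in> W \<Longrightarrow> connected_component W x (H (t, x))"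
    "\<And>x y. connected_component W x y \<Longrightarrow> q x = q y"
proof -
  have "\<exists>h a. continuous_on ({0..1} \<times> U) h \<and> h ` ({0..1} \<times> U) \<subseteq> U \<and> (\<forall>x\<in>U. h (0::real, x) = x) \<and> (\<forall>x\<in>U. h (1, x) = a)"
    if U: "U \<in> components W" for U
  proof -
    obtain a where "homotopic_with_canon (\<lambda>_. True) U U id (\<lambda>x. a)"
      using contr U unfolding contractible_def by blast
    then show ?thesis
      by (simp add: homotopic_with image_subset_iff_funcset) blast
  qed
  then obtain h a where h: "\<And>U. U \<in> components W \<Longrightarrow> continuous_on ({0..1} \<times> U) (h U)"
    "\<And>U. U \<in> components W \<Longrightarrow> h U ` ({0..1} \<times> U) \<subseteq> U"
    "\<And>U x. U \<in> components W \<Longrightarrow> x \<in> U \<Longrightarrow> h U (0::real, x) = x"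
    "\<And>U x. U \<in> components W \<Longrightarrow> x \<in> U \<Longrightarrow> h U (1, x) = a U"
    by metis
  let ?C = "\<lambda>x. connected_component_set W x"
  define H where "H = (\<lambda>z. h (?C (snd z)) z)"
  have comp: "?C x \<in> components W" "x \<in> ?C x" if "x \<in> W" for x
    using that by (auto simp: components_def)
  show ?thesis
  proof (rule that[of H "\<lambda>x. a (?C x)"])
    show "continuous_on ({0..1} \<times> W) H"
      unfolding continuous_on_eq_continuous_within
    proof
      fix z :: "real \<times> 'a" assume z: "z \<in> {0..1} \<times> W"
      let ?U = "?C (snd z)"
      have U: "?U \<in> components W" "snd z \<in> ?U" using z comp by auto
      have eq: "?C x = ?U" if "x \<in> ?U" for x using that by (metis connected_component_eq)
      have "continuous_on ({0..1} \<times> ?U) H"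
        using h(1)[OF U(1)] by (rule continuous_on_cong[THEN iffD1, rotated 2]) (auto simp: H_def eq)
      then have "continuous (at z within {0..1} \<times> ?U) H"
        using z U(2) by (auto simp: continuous_on_eq_continuous_within)
      moreover have "at z within {0..1} \<times> ?U = at z within {0..1} \<times> W"
        by (rule at_within_nhd[of z "UNIV \<times> ?U"])
           (use z U(2) W connected_component_subset[of W] in \<open>auto intro!: open_Times open_connected_component\<close>)
      ultimately show "continuous (at z within {0..1} \<times> W) H" by simp
    qed
    show "connected_component W x (H (t, x))" if "t \<in> {0..1}" "x \<in> W" for t x
      using h(2)[OF comp(1)[OF that(2)]] that comp(2)[OF that(2)] by (force simp: H_def)
    show "a (?C x) = a (?C y)" if "connected_component W x y" for x y
      using connected_component_eq[of y W x] that by simp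
  qed (use h(3,4) comp in \<open>auto simp: H_def\<close>)
qed

section \<open>Level sets of the potential\<close>

context steep_gradient
begin

lemma M_nonneg: "M \<ge> 0"
  using M[of 0] R by simp

text \<open>Descending trajectories connect every point of the sublevel set to the frozen disc.\<close>

lemma sublevel_connected: "connected {x. \<phi> x \<le> M}"
proof -
  let ?S = "{x. \<phi> x \<le> M}"
  interpret D: steep_gradient "\<lambda>x. - \<phi> x" "\<lambda>x. - f x" R M by (rule dual)
  have *: "connected_component ?S 0 y" if y: "y \<in> ?S" for y
  proof -
    obtain F :: "complex \<Rightarrow> complex" where F: "continuous_on UNIV F"
      "\<And>x. norm x \<le> R \<Longrightarrow> F x = x"
      "\<And>x. norm x \<le> norm y \<Longrightarrow> - \<phi> (F x) < - M \<Longrightarrow> 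
          \<exists>z. norm z \<le> R + 1 \<and> - \<phi> x \<le> - \<phi> z \<and> norm (F x - z) \<le> - \<phi> (F x) - - \<phi> z"
      "\<And>x. norm x \<le> norm y \<Longrightarrow> \<exists>C. connected C \<and> x \<in> C \<and> F x \<in> C \<and> C \<subseteq> {z. - \<phi> x \<le> - \<phi> z}"
      by (rule D.flow[OF norm_ge_zero, of y "-M"]) (rule that; blast)
    \<comment> \<open>Ending above \<open>M\<close> would force a visit to
      \<open>cball 0 (R + 1)\<close>, where \<open>\<phi>\<close> is at most \<open>M\<close>,
      followed by a descent.\<close>
    have le: "\<phi> (F x) \<le> M" if x: "norm x \<le> norm y" for x
    proof (rule ccontr)
      assume "\<not> ?thesis"
      then have gt: "M < \<phi> (F x)" by simp
      then obtain z where "norm z \<le> R + 1" "norm (F x - z) \<le> - \<phi> (F x) - - \<phi> z" using F(3)[OF x] by auto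
      then show False using M[of z] norm_ge_zero[of "F x - z"] gt by linarith
    qed
    \<comment> \<open>The flow carries the radius from \<open>0\<close> to \<open>y\<close> into the
      sublevel set and fixes \<open>0\<close>; the connected set attached to the orbit of
      \<open>y\<close> then joins \<open>F y\<close> to \<open>y\<close>.\<close>
    have "connected (F ` closed_segment 0 y)"
      by (intro connected_continuous_image continuous_on_subset[OF F(1)]) auto
    moreover have "F ` closed_segment 0 y \<subseteq> ?S"
      using le segment_bound[of _ 0 y] by fastforce
    moreover have "0 \<in> F ` closed_segment 0 y"
      using F(2)[of 0] R by (intro image_eqI[of _ _ 0]) auto
    moreover have "F y \<in> F ` closed_segment 0 y" by auto
    ultimately have "connected_component ?S 0 (F y)"
      unfolding connected_component_def by blast
    moreover obtain C where "connected C" "y \<in> C" "F y \<in> C" "C \<subseteq> {z. - \<phi> y \<le> - \<phi> z}"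
      using F(4)[of y] by auto
    then have "connected_component ?S (F y) y"
      unfolding connected_component_def using y by (intro exI[of _ C]) auto
    ultimately show ?thesis by (rule connected_component_trans)
  qed
  show ?thesis
    unfolding connected_iff_connected_component
    using * connected_component_sym connected_component_trans by (metis (lifting))
qed

text \<open>A component of the complement of a connected set has connected complement. As this is
  also unbounded, \<open>U\<close> encloses nothing, so the planar open set \<open>U\<close> is
  simply connected and hence contractible.\<close>

lemma superlevel_component_contractible:
  assumes "\<not> bounded {x. \<phi> x \<le> M}" "U \<in> components {x. M < \<phi> x}"
  shows "contractible U"
proof -
  have op: "open {x. M < \<phi> x}" by (intro open_Collect_less cont_phi continuous_intros)
  have "- {x. \<phi> x \<le> M} = {x. M < \<phi> x}" by auto
  then have conn: "connected (- U)"
    using component_complement_connected[OF sublevel_connected] assms(2) by simp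
  have "{x. \<phi> x \<le> M} \<subseteq> - U" using in_components_subset[OF assms(2)] by auto
  then have unb: "\<not> bounded (- U)" using assms(1) bounded_subset by blast
  have "inside U = {}"
    using conn unb connected_component_eq_self[OF conn] by (auto simp: inside_def)
  moreover have "open U" "connected U"
    using open_components[OF op assms(2)] in_components_connected[OF assms(2)] by auto
  ultimately show ?thesis
    by (simp add: contractible_eq_simply_connected_2d simply_connected_eq_empty_inside)
qed

text \<open>\<open>n\<close> is the number of contraction points of components meeting the compact
  set \<open>T\<close>. Assuming contractibility instead of an unbounded sublevel set also covers an
  empty superlevel set, as needed for \<open>- \<phi>\<close>.\<close>

lemma circ_wn_if_contractible:
  assumes contr: "\<forall>U\<in>components {x. M < \<phi> x}. contractible U"
  shows "\<exists>n. circ_wn f 0 (R + 1) = 1 - of_nat n"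
proof -
  let ?W = "{x. M < \<phi> x}"
  let ?C = "connected_component_set ?W"
  have W: "open ?W" by (intro open_Collect_less cont_phi continuous_intros)
  obtain H :: "real \<times> complex \<Rightarrow> complex" and q where H: "continuous_on ({0..1} \<times> ?W) H"
    "\<And>x. x \<in> ?W \<Longrightarrow> H (0, x) = x" "\<And>x. x \<in> ?W \<Longrightarrow> H (1, x) = q x"
    "\<And>t x. t \<in> {0..1} \<Longrightarrow> x \<in> ?W \<Longrightarrow> connected_component ?W x (H (t, x))"
    "\<And>x y. connected_component ?W x y \<Longrightarrow> q x = q y"
  proof (rule contract_components[OF W contr], goal_cases)
    case (1 H q)
    show ?case by (rule that[of H q]) (use 1 in blast)+
  qed
  have HW: "H (t, x) \<in> ?W" if "t \<in> {0..1}" "x \<in> ?W" for t x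
    using H(4)[OF that] connected_component_in by fastforce
  have qW: "q x \<in> ?W" "q (q x) = q x" if x: "x \<in> ?W" for x
  proof -
    have one: "(1::real) \<in> {0..1}" by simp
    show "q x \<in> ?W" using HW[OF one x] unfolding H(3)[OF x] .
    show "q (q x) = q x" using H(5)[OF H(4)[OF one x]] unfolding H(3)[OF x] by (rule sym)
  qed
  \<comment> \<open>An orbit that visits \<open>y\<close> in \<open>cball 0 (R + 1)\<close> and ends
    below \<open>M + 2\<close> ends within radius \<open>R + 1 + (M + 2) - \<phi> y\<close>, and
    \<open>\<phi> y \<ge> - M\<close>.\<close>
  define R3 where "R3 = R + 2 * M + 3"
  \<comment> \<open>\<open>T\<close> catches all values of the flow from level \<open>M + 1\<close>
    to below \<open>M + 2\<close>; being compact, it meets only finitely many components.\<close>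
  define T where "T = cball 0 R3 \<inter> {x. M + 1 \<le> \<phi> x}"
  have "closed {x. M + 1 \<le> \<phi> x}" by (intro closed_Collect_le cont_phi continuous_intros)
  then have T: "compact T" unfolding T_def by (intro compact_Int_closed) auto
  have TW: "T \<subseteq> ?W" by (auto simp: T_def)
  have Cin: "x \<in> ?C x" if "x \<in> ?W" for x using that by simp
  have "finite (q ` T)"
  proof -
    have "\<And>U. U \<in> components ?W \<Longrightarrow> open U" using open_components[OF W] .
    moreover have "T \<subseteq> \<Union>(components ?W)" using TW by (simp only: Union_components)
    ultimately obtain D where D: "D \<subseteq> components ?W" "finite D" "T \<subseteq> \<Union>D"
      using compactE[OF T] by metis
    have "q ` T \<subseteq> (\<lambda>U. q (SOME x. x \<in> U)) ` D"
    proof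
      fix y assume "y \<in> q ` T"
      then obtain x U where x: "y = q x" "x \<in> U" "U \<in> D" using D(3) by auto
      then have "(SOME x. x \<in> U) \<in> U" by (meson someI_ex)
      moreover have "connected_component ?W x z" if "z \<in> U" for z
        using x D(1) that by (metis connected_component_in in_components_connected in_components_subset 
            connected_component_def subsetD)
      ultimately show "y \<in> (\<lambda>U. q (SOME x. x \<in> U)) ` D" using H(5) x by blast
    qed
    then show ?thesis using D(2) finite_surj by blast
  qed
  define Q where "Q = q ` T"
  have Q: "finite Q" using \<open>finite (q ` T)\<close> by (simp add: Q_def)
  have "compact (H ` ({0..1} \<times> T))"
    by (intro compact_continuous_image compact_Times T continuous_on_subset[OF H(1)]) (use TW in auto)
  then have "bounded (H ` ({0..1} \<times> T) \<union> Q \<union> cball 0 R3)"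
    using Q by (auto intro: compact_imp_bounded finite_imp_bounded)
  then obtain R4 where R4: "\<And>x. x \<in> H ` ({0..1} \<times> T) \<union> Q \<union> cball 0 R3 \<Longrightarrow> norm x \<le> R4"
    unfolding bounded_iff by blast
  \<comment> \<open>Strictly beyond \<open>R4\<close>, which bounds the map \<open>Fh\<close> below
    on the disc, so that the disc is mapped into its interior.\<close>
  define \<rho> where "\<rho> = max R4 (R + 1) + 1"
  have \<rho>: "\<rho> > R4" "\<rho> > R + 1" "\<rho> \<ge> 0" using R by (auto simp: \<rho>_def)
  obtain F :: "complex \<Rightarrow> complex" where F: "continuous_on UNIV F"
    "\<And>x. norm x \<le> R \<Longrightarrow> F x = x"
    "\<And>x. norm x \<le> \<rho> \<Longrightarrow> \<phi> (F x) < M + 2 \<Longrightarrow> 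
          \<exists>y. norm y \<le> R + 1 \<and> \<phi> x \<le> \<phi> y \<and> norm (F x - y) \<le> \<phi> (F x) - \<phi> y"
    "\<And>x. norm x \<le> \<rho> \<Longrightarrow> \<exists>C. connected C \<and> x \<in> C \<and> F x \<in> C \<and> C \<subseteq> {z. \<phi> x \<le> \<phi> z}"
    "\<And>x. R < norm x \<Longrightarrow> norm x \<le> \<rho> \<Longrightarrow> \<phi> x < M + 2 + 1 \<Longrightarrow> \<phi> x < \<phi> (F x)"
    "\<And>r. R < r \<Longrightarrow> r \<le> \<rho> \<Longrightarrow> (\<And>x. norm x = r \<Longrightarrow> \<phi> x < M + 2 + 1) \<Longrightarrow>
          circ_wn (\<lambda>x. x - F x) 0 r = circ_wn f 0 r"
  proof (rule flow[OF \<rho>(3), of "M + 2"], goal_cases)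
    case (1 F)
    show ?case by (rule that[of F]) (fact 1)+
  qed
  have contF: "continuous_on S F" for S using F(1) continuous_on_subset by blast
  have cont\<phi>F: "continuous_on S (\<lambda>x. \<phi> (F x))" for S
    by (rule continuous_on_compose2[OF cont_phi[of UNIV] contF]) auto
  \<comment> \<open>Ending below \<open>M + 2\<close>, the orbit would have visited
    \<open>cball 0 (R + 1)\<close> at a level no lower than \<open>\<phi> x > M\<close>, against the
    choice of \<open>M\<close>.\<close>
  have Fup: "\<phi> (F x) \<ge> M + 2" if "norm x \<le> \<rho>" "\<phi> x > M" for x
    using F(3)[OF that(1)] M that(2) by (meson abs_le_iff leD le_less_trans not_le order_less_le_trans)
  have Fnear: "norm (F x) \<le> R3" if x: "norm x \<le> \<rho>" "\<phi> (F x) < M + 2" for x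
  proof -
    obtain y where y: "norm y \<le> R + 1" "norm (F x - y) \<le> \<phi> (F x) - \<phi> y" using F(3)[OF x] by blast
    then show ?thesis using M[OF y(1)] x(2) norm_triangle_sub[of "F x" y] by (simp add: R3_def)
  qed
  have Fcomp: "connected_component ?W x (F x)" if x: "norm x \<le> \<rho>" "\<phi> x > M" for x
  proof -
    obtain C where "connected C" "x \<in> C" "F x \<in> C" "C \<subseteq> {z. \<phi> x \<le> \<phi> z}" using F(4)[OF x(1)] by blast
    then show ?thesis unfolding connected_component_def using x(2) by (intro exI[of _ C]) auto
  qed
  \<comment> \<open>The points of the disc sent high up into a component that misses \<open>T\<close> form a clopen set avoiding \<open>0\<close>.\<close>
  have meets: "?C (F x) \<inter> T \<noteq> {}" if x: "norm x \<le> \<rho>" "\<phi> (F x) > M + 1" for x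
  proof -
    define G where "G = \<Union>{U \<in> components ?W. U \<inter> T = {}}"
    define G' where "G' = \<Union>{U \<in> components ?W. U \<inter> T \<noteq> {}}"
    have op: "open G" "open G'" unfolding G_def G'_def using open_components[OF W] by auto
    have GW: "y \<in> G \<longleftrightarrow> y \<in> ?W \<and> ?C y \<inter> T = {}" "y \<in> G' \<longleftrightarrow> y \<in> ?W \<and> ?C y \<inter> T \<noteq> {}" for y
      unfolding G_def G'_def components_def
      using connected_component_eq[of y ?W] connected_component_in[of ?W _ y] Cin[of y] by fastforce+
    define B where "B = cball 0 \<rho> \<inter> F -` (G \<inter> {y. M + 1 < \<phi> y})"
    \<comment> \<open>Values of \<open>F\<close> between the two levels lie in \<open>T\<close>,
      which \<open>G\<close> misses; so on \<open>B\<close> the open condition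
      \<open>M + 1 < \<phi>\<close> improves to the closed one \<open>M + 2 \<le> \<phi>\<close>,
      and \<open>B\<close> is clopen in the disc.\<close>
    have up: "\<phi> (F y) \<ge> M + 2" if y: "y \<in> B" for y
    proof (rule ccontr)
      assume "\<not> ?thesis"
      then have "F y \<in> T" using Fnear[of y] y by (auto simp: B_def T_def)
      moreover from this have "F y \<in> ?C (F y)" using TW Cin by blast
      moreover have "?C (F y) \<inter> T = {}" using y GW(1)[of "F y"] by (simp add: B_def)
      ultimately show False by blast
    qed
    have "openin (top_of_set (cball 0 \<rho>)) B"
      unfolding B_def
      by (intro continuous_openin_preimage_gen contF open_Int op open_Collect_less cont_phi continuous_intros)
    moreover have "B = cball 0 \<rho> \<inter> F -` ({y. M + 2 \<le> \<phi> y} \<inter> - G')"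
      using up GW by (fastforce simp: B_def)
    then have "closedin (top_of_set (cball 0 \<rho>)) B"
      using op
      by (simp only:) (intro continuous_closedin_preimage contF closed_Int closed_Compl closed_Collect_le cont_phi continuous_intros)
    moreover have "0 \<notin> B" using F(2)[of 0] M[of 0] R by (auto simp: B_def)
    moreover have "(0::complex) \<in> cball 0 \<rho>" using \<rho> by simp
    moreover have "connected (cball (0::complex) \<rho>)" by simp
    ultimately have "B = {}" unfolding connected_clopen by metis
    then show ?thesis using x GW[of "F x"] by (auto simp: B_def)
  qed
  \<comment> \<open>At level \<open>M + 1\<close> the contraction has not started, so it glues with
    the plain flow; from \<open>M + 2\<close> on it is complete.\<close>
  define lam where "lam = (\<lambda>x. min 1 (max 0 (\<phi> (F x) - M - 1)))"
  have lam: "lam x \<in> {0..1}" "\<phi> (F x) = M + 1 \<Longrightarrow> lam x = 0" "\<phi> (F x) \<ge> M + 2 \<Longrightarrow> lam x = 1" for x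
    by (auto simp: lam_def)
  have tlam: "t * lam x \<in> {0..1}" if "t \<in> {0..1}" for t x
    using that lam(1)[of x] mult_le_one[of t "lam x"] by simp
  have contlam: "continuous_on S lam" for S unfolding lam_def by (intro continuous_intros cont\<phi>F)
  \<comment> \<open>\<open>K\<close> deforms \<open>F\<close> into the map \<open>Fh\<close> below, by contracting the components between the levels \<open>M + 1\<close> and \<open>M + 2\<close>.\<close>
  define K where "K = (\<lambda>z. if \<phi> (F (snd z)) \<le> M + 1 then F (snd z) else H (fst z * lam (snd z), F (snd z)))"
  have contK: "continuous_on ({0..1} \<times> S) K" for S
    unfolding K_def
  proof (rule continuous_on_cases_le)
    show "continuous_on {t \<in> {0..1} \<times> S. \<phi> (F (snd t)) \<le> M + 1} (\<lambda>t. F (snd t))"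
      by (rule continuous_on_compose2[OF contF[of UNIV]]) (auto intro!: continuous_intros)
    show "continuous_on ({0..1} \<times> S) (\<lambda>t. \<phi> (F (snd t)))"
      by (rule continuous_on_compose2[OF cont\<phi>F[of UNIV]]) (auto intro!: continuous_intros)
    show "continuous_on {t \<in> {0..1} \<times> S. M + 1 \<le> \<phi> (F (snd t))} (\<lambda>t. H (fst t * lam (snd t), F (snd t)))"
    proof (rule continuous_on_compose2[OF H(1)])
      show "continuous_on {t \<in> {0..1} \<times> S. M + 1 \<le> \<phi> (F (snd t))} (\<lambda>t. (fst t * lam (snd t), F (snd t)))"
        by (intro continuous_intros continuous_on_compose2[OF contlam[of UNIV]] continuous_on_compose2[OF contF[of UNIV]]) auto
    qed (use tlam in fastforce)
  qed (use H(2) lam in auto)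
  define Fh where "Fh = (\<lambda>x. K (1, x))"
  have contFh: "continuous_on S Fh" for S
    unfolding Fh_def by (rule continuous_on_compose2[OF contK[of S]]) (auto intro!: continuous_intros)
  have Fh_q: "Fh x = q (F x)" if "\<phi> (F x) \<ge> M + 2" for x
    using that lam(3)[OF that] H(3)[of "F x"] by (simp add: Fh_def K_def)
  have qQ: "q (F x) \<in> Q" if "norm x \<le> \<rho>" "\<phi> (F x) > M + 1" for x
    using meets[OF that] H(5)[of "F x"] unfolding Q_def by blast
  have Fh_in: "Fh x = q x" "q x \<in> Q" if x: "norm x \<le> \<rho>" "\<phi> x > M" for x
    using Fh_q[OF Fup[OF x]] H(5)[OF Fcomp[OF x]] qQ[OF x(1)] Fup[OF x] by auto
  \<comment> \<open>Up to level \<open>M + 1\<close> the flow has stayed near; in between,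
    \<open>F x\<close> lies in \<open>T\<close>; from \<open>M + 2\<close> on the value is one of
    the finitely many points of \<open>Q\<close>.\<close>
  have Fh_bd: "norm (Fh x) \<le> R4" if x: "norm x \<le> \<rho>" for x
  proof -
    consider "\<phi> (F x) \<le> M + 1" | "M + 1 < \<phi> (F x)" "\<phi> (F x) < M + 2" | "M + 2 \<le> \<phi> (F x)" by linarith
    then show ?thesis
    proof cases
      case 1 then show ?thesis using Fnear[OF x] R4[of "F x"] by (simp add: Fh_def K_def)
    next
      case 2
      then have "F x \<in> T" using Fnear[OF x] by (simp add: T_def)
      then have "Fh x \<in> H ` ({0..1} \<times> T)" using 2 lam(1)[of x] by (simp add: Fh_def K_def)
      then show ?thesis using R4 by blast
    next
      case 3 then show ?thesis using Fh_q qQ[OF x] R4 by auto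
    qed
  qed
  \<comment> \<open>A fixed point with \<open>F x\<close> at most at level \<open>M + 1\<close>
    would be fixed by \<open>F\<close>, which raises \<open>\<phi>\<close> strictly there; any other
    lies in \<open>?W\<close>, where \<open>Fh\<close> equals \<open>q\<close>.\<close>
  have fix_Q: "x \<in> Q" if x: "R + 1 \<le> norm x" "norm x \<le> \<rho>" "Fh x = x" for x
  proof (cases "\<phi> (F x) \<le> M + 1")
    case True
    then have "F x = x" using x(3) by (simp add: Fh_def K_def)
    then show ?thesis using F(5)[of x] x True by simp
  next
    case False
    then have "x \<in> ?W" using HW[of "lam x" "F x"] lam(1)[of x] x(3) by (simp add: Fh_def K_def)
    then show ?thesis using Fh_in[of x] x by auto
  qed
  have QW: "a \<in> ?W" "q a = a" "norm a \<le> R4" if "a \<in> Q" for a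
    using that qW TW R4 by (auto simp: Q_def)
  have Qfar: "norm a > R + 1" if "a \<in> Q" for a
    using QW(1)[OF that] M[of a] by force
  have "circ_wn (\<lambda>x. x - Fh x) 0 \<rho> = circ_wn (\<lambda>x. x - Fh x) 0 (R + 1) + of_int (\<Sum>a\<in>Q. 1)"
  proof (rule circ_wn_eq_sum_annulus[OF Q])
    show "Q \<subseteq> ball 0 \<rho> - cball 0 (R + 1)" using Qfar QW(3) \<rho>(1) by force
    show "x - Fh x \<noteq> 0" if "x \<in> cball 0 \<rho> - ball 0 (R + 1) - Q" for x
      using fix_Q[of x] that by auto
    show "continuous_on (cball 0 \<rho> - ball 0 (R + 1) - Q) (\<lambda>x. x - Fh x)"
      by (intro continuous_intros contFh)
    fix a assume a: "a \<in> Q"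
    have "open (?C a \<inter> ball 0 \<rho>)" "a \<in> ?C a \<inter> ball 0 \<rho>"
      using W Cin QW[OF a] \<rho>(1) by (auto intro: open_connected_component)
    then obtain e where e: "e > 0" "cball a e \<subseteq> ?C a \<inter> ball 0 \<rho>" by (meson open_contains_cball)
    show "\<forall>\<^sub>F r in at_right 0. circ_wn (\<lambda>x. x - Fh x) a r = of_int 1"
      using eventually_at_right_real[OF e(1)]
    proof eventually_elim
      case (elim r)
      \<comment> \<open>Near \<open>a\<close> the map \<open>Fh\<close> is constantly
        \<open>a\<close>, so the index of \<open>a\<close> is \<open>1\<close>.\<close>
      have "circ_wn (\<lambda>x. x - Fh x) a r = circ_wn (\<lambda>x. x - a) a r"
      proof (rule circ_wn_cong)
        fix x assume "x \<in> sphere a r"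
        then have x: "x \<in> ?C a \<inter> ball 0 \<rho>" using e(2) elim by (auto simp: subset_iff)
        then have "M < \<phi> x" using connected_component_in[of ?W a x] by auto
        then show "x - Fh x = x - a" using Fh_in(1)[of x] H(5)[of a x] x QW(2)[OF a] by auto
      qed (use elim in auto)
      then show ?case using circ_wn_diff[of r a a] elim by simp
    qed
  qed (use \<rho> R in auto)
  \<comment> \<open>\<open>Fh\<close> maps the bounding circle into the open disc, so scaling
    \<open>Fh\<close> down to \<open>0\<close> creates no fixed point on it: the total index is
    \<open>1\<close>.\<close>
  moreover have "circ_wn (\<lambda>x. x - Fh x) 0 \<rho> = 1"
  proof -
    have "circ_wn (\<lambda>x. x - Fh x) 0 \<rho> = circ_wn (\<lambda>x. x - 0) 0 \<rho>"
    proof (rule circ_wn_linear)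
      fix x :: complex assume "x \<in> sphere 0 \<rho>"
      then have x: "norm x = \<rho>" by simp
      show "0 \<notin> closed_segment (x - Fh x) (x - 0)"
      proof
        assume "0 \<in> closed_segment (x - Fh x) (x - 0)"
        then obtain s where s: "0 \<le> s" "s \<le> 1" "x = (1 - s) *\<^sub>R Fh x"
          by (auto simp: in_segment algebra_simps)
        have "norm x = (1 - s) * norm (Fh x)" using s by (metis abs_of_nonneg diff_ge_0_iff_ge norm_scaleR)
        also have "\<dots> \<le> norm (Fh x)" using s by (intro mult_left_le_one_le) auto
        finally show False using Fh_bd[of x] x \<rho>(1) by simp
      qed
    qed (use \<rho> in \<open>auto intro!: continuous_intros contFh\<close>)
    then show ?thesis using circ_wn_diff[of \<rho> 0 0] \<rho> R by simp
  qed
  moreover have "circ_wn (\<lambda>x. x - Fh x) 0 (R + 1) = circ_wn f 0 (R + 1)"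
  proof -
    \<comment> \<open>Undoing the contraction creates no fixed point on this circle: there
      \<open>\<phi> x \<le> M\<close>, while \<open>K (t, x)\<close> is either \<open>F x\<close>,
      strictly higher than \<open>x\<close>, or a point of \<open>?W\<close>.\<close>
    have low: "\<phi> x \<le> M" if "norm x = R + 1" for x using M[of x] that by auto
    have "circ_wn (\<lambda>x. x - K (0, x)) 0 (R + 1) = circ_wn (\<lambda>x. x - K (1, x)) 0 (R + 1)"
    proof (rule circ_wn_homotopy[of "R + 1" 0 "\<lambda>z. snd z - K z", unfolded snd_conv])
      show "continuous_on ({0..1} \<times> sphere 0 (R + 1)) (\<lambda>z. snd z - K z)"
        by (intro continuous_intros contK)
      fix t :: real and x :: complex assume t: "t \<in> {0..1}" and "x \<in> sphere 0 (R + 1)"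
      then have x: "norm x = R + 1" by simp
      show "x - K (t, x) \<noteq> 0"
      proof (cases "\<phi> (F x) \<le> M + 1")
        case True
        then show ?thesis using F(5)[of x] x \<rho> low[OF x] by (auto simp: K_def)
      next
        case False
        have "t * lam x \<in> {0..1}" using tlam[OF t] .
        then have "K (t, x) \<in> ?W" using HW[of "t * lam x" "F x"] False by (simp add: K_def)
        then show ?thesis using low[OF x] by auto
      qed
    qed (use R in auto)
    moreover have "K (0, x) = F x" for x using H(2)[of "F x"] by (auto simp: K_def)
    moreover have "circ_wn (\<lambda>x. x - F x) 0 (R + 1) = circ_wn f 0 (R + 1)"
      using \<rho> low by (intro F(6)) force+
    ultimately show ?thesis by (simp add: Fh_def)
  qed
  ultimately show ?thesis by (intro exI[of _ "card Q"]) (simp add: algebra_simps)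
qed

lemma circ_wn_le_1: "\<exists>n. circ_wn f 0 (R + 1) = 1 - of_nat n"
proof (cases "bounded {x. \<phi> x \<le> M}")
  case False
  then show ?thesis using circ_wn_if_contractible superlevel_component_contractible by blast
next
  case True
  have "closed {x. \<phi> x \<le> M}" by (intro closed_Collect_le cont_phi continuous_intros)
  then have "compact {x. \<phi> x \<le> M}" using True compact_eq_bounded_closed by blast
  moreover have "{x. \<phi> x \<le> M} \<noteq> {}" using M[of 0] R by (auto intro!: exI[of _ 0])
  ultimately obtain x0 where "\<forall>x\<in>{x. \<phi> x \<le> M}. \<phi> x0 \<le> \<phi> x"
    using continuous_attains_inf[OF _ _ cont_phi] by blast
  \<comment> \<open>With this bound the set where \<open>- \<phi>\<close> exceeds \<open>M'\<close>
    is empty, so the contractibility hypothesis holds vacuously for the negated potential.\<close>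
  moreover define M' where "M' = max M (- \<phi> x0)"
  ultimately have M': "- \<phi> x \<le> M'" for x
    using M_nonneg by (cases "\<phi> x \<le> M") (force simp: max_def)+
  interpret D: steep_gradient "\<lambda>x. - \<phi> x" "\<lambda>x. - f x" R M'
    using dual M by (simp add: steep_gradient_def M'_def max_def) fastforce
  have "{x. M' < - \<phi> x} = {}" using M' by (auto simp: not_less)
  then have "\<exists>n. circ_wn (\<lambda>x. - f x) 0 (R + 1) = 1 - of_nat n"
    using D.circ_wn_if_contractible by simp
  \<comment> \<open>In the plane negation is a rotation, so it preserves winding numbers.\<close>
  moreover have "circ_wn (\<lambda>x. - f x) 0 (R + 1) = circ_wn f 0 (R + 1)"
  proof (rule circ_wn_minus)
    show "f x \<noteq> 0" if "x \<in> sphere 0 (R + 1)" for x using steep[of x] that by auto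
  qed (use R contf continuous_on_subset in auto)
  ultimately show ?thesis by simp
qed

end

section \<open>The degree bound for proper gradient maps of the plane\<close>

lemma proper_gradient_deg_le_1:
  fixes f :: "real^2 \<Rightarrow> real^2"
  assumes "proper_on UNIV f" "gradient_map f"
  shows "deg f \<le> 1"
proof -
  have contf: "continuous_on UNIV f" and "compact (f -` cball 0 2)"
    using assms(1) unfolding proper_on_def by auto
  then obtain R where R: "R > 0" "\<And>x. f x \<in> cball 0 2 \<Longrightarrow> norm x < R"
    using compact_imp_bounded[of "f -` cball 0 2"] unfolding bounded_pos_less by auto
  have steep: "norm (f x) \<ge> 2" if "norm x \<ge> R" for x using R(2)[of x] that by force
  obtain \<phi> where \<phi>: "\<And>x. (\<phi> has_derivative (\<lambda>h. f x \<bullet> h)) (at x)"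
    using assms(2) unfolding gradient_map_def gderiv_def inner_commute[of _ "f _"] by blast
  have cont\<phi>: "continuous_on S \<phi>" for S
    using has_derivative_continuous[OF \<phi>] by (simp add: continuous_at_imp_continuous_on)
  have "compact (\<phi> ` cball 0 (R + 1))" by (intro compact_continuous_image cont\<phi>) auto
  then obtain M where "\<forall>x\<in>cball 0 (R + 1). \<bar>\<phi> x\<bar> \<le> M"
    using compact_imp_bounded[of "\<phi> ` cball 0 (R + 1)"] unfolding bounded_iff by auto
  then have M: "\<And>x. norm x \<le> R + 1 \<Longrightarrow> \<bar>\<phi> x\<bar> \<le> M" by simp
  interpret G: steep_gradient "\<lambda>z. \<phi> (of_complex z)" "conj_map f" R M
  proof
    fix z
    have "((\<lambda>z. \<phi> (of_complex z)) has_derivative (\<lambda>h. f (of_complex z) \<bullet> of_complex h)) (at z)"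
      by (rule has_derivative_compose[OF bounded_linear_imp_has_derivative[OF bounded_linear_of_complex] \<phi>])
    moreover have "f (of_complex z) \<bullet> of_complex h = conj_map f z \<bullet> h" for h
      unfolding conj_map_def using inner_to_complex[of "f (of_complex z)" "of_complex h"] by simp
    ultimately show "((\<lambda>z. \<phi> (of_complex z)) has_derivative (\<lambda>h. conj_map f z \<bullet> h)) (at z)" by simp
  next
    show "continuous_on UNIV (conj_map f)"
      unfolding conj_map_def by (intro continuous_intros continuous_on_compose2[OF contf]) auto
  qed (use R(1) steep M in \<open>auto simp: conj_map_def\<close>)
  obtain n where "circ_wn (conj_map f) 0 (R + 1) = 1 - of_nat n" using G.circ_wn_le_1 by blast
  moreover have "of_int (deg f) = circ_wn (conj_map f) 0 (R + 1)"
  proof (rule deg_eq_circ_wn[OF contf])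
    show "f x \<noteq> 0" if "norm x \<ge> R + 1" for x using steep[of x] that by auto
  qed (use R(1) in simp)
  ultimately have "complex_of_int (deg f) = of_int (1 - int n)" by simp
  then show ?thesis unfolding of_int_eq_iff by simp
qed

theorem theorem2p2:
  fixes k :: int
  assumes "k > 1"
  shows "(proper_gradient_classes k :: (real^2 \<Rightarrow> real^2) set set) = {} \<and>
         \<not> (\<exists>f :: real^2 \<Rightarrow> real^2. proper_on UNIV f \<and> gradient_map f \<and> deg f = k)"
proof -
  have none: "\<not> (\<exists>f :: real^2 \<Rightarrow> real^2. proper_on UNIV f \<and> gradient_map f \<and> deg f = k)"
    using proper_gradient_deg_le_1 assms by force
  then have "(proper_gradient_maps k :: (real^2 \<Rightarrow> real^2) set) = {}"
    by (auto simp: proper_gradient_maps_def)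
  then show ?thesis using none by (simp add: proper_gradient_classes_def quotient_def)
qed

end
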